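(* Let $p$ be a prime, $s,n$ positive integers, $G$ a primary commutative group of order $p^s$, i.e. $G\cong C_p\times\cdots\times C_p$ ($s$ factors), and $F$ a field containing a primitive $|G|$-th root of $1$. Let $\mathcal N(G,n)$ be the number of isomorphism classes of element systems with characters over $G$ (with values in $F$) indexed by $\{1,\dots,n\}$. Then $$\mathcal N(G,n)=\frac{1}{p^{\frac12 s(s-1)}\prod_{i=1}^{s}(p^i-1)}\sum_{A\in GL(s,\mathbb Z_p)}\ \sum_{\lambda_1+2\lambda_2+\cdots+n\lambda_n=n}\ \prod_{i=1}^{n}\frac{p^{2(s-\mathrm{rank}(A^i-I))\lambda_i}}{\lambda_i!\,i^{\lambda_i}},$$ where the inner sum is over all $n$-tuples $(\lambda_1,\dots,\lambda_n)$ of non-negative integers with $\lambda_1+2\lambda_2+\cdots+n\lambda_n=n$, $I$ is the $s\times s$ identity matrix, and the rank is taken over the field $\mathbb Z_p=\mathbb Z/p\mathbb Z$.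
   Context: For a finite abelian group $G$ of order $m$ and a field $F$ containing a primitive $m$-th root of $1$, $\widehat G$ denotes the set of characters of $G$, i.e. group homomorphisms $G\to F\setminus\{0\}$. An element system with characters (ESC) over $G$ indexed by a set $J$ is a pair of families $(g_i)_{i\in J}$, $(\chi_i)_{i\in J}$ with $g_i\in G$, $\chi_i\in\widehat G$. Two ESCs $(g_i,\chi_i)_{i\in J}$ over $G$ and $(g_i',\chi_i')_{i\in J'}$ over $G'$ are isomorphic if there are a group isomorphism $\phi:G\to G'$ and a bijection $\sigma:J\to J'$ such that $\phi(g_i)=g'_{\sigma(i)}$ and $\chi'_{\sigma(i)}\circ\phi=\chi_i$ for all $i\in J$. For a positive integer $n$, $\mathcal N(G,n)$ is the number of isomorphism classes of ESCs over $G$ indexed by $J=\{1,\dots,n\}$. $C_p$ is the cyclic group of order $p$. *)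

theory Defs
  imports
    "HOL-Algebra.Multiplicative_Group"
    "HOL-Algebra.Elementary_Groups"
    "HOL-Algebra.Product_Groups"
    "Jordan_Normal_Form.DL_Rank"
    "Berlekamp_Zassenhaus.Finite_Field"
begin

(* HOL-Algebra homomorphisms are total functions that are unconstrained off the carrier.
   Requiring the value undefined there makes distinct elements of this set distinct characters. *)
definition characters ::
    "('a, 'm) monoid_scheme \<Rightarrow> ('f, 'r) ring_scheme \<Rightarrow> ('a \<Rightarrow> 'f) set" where
  "characters G F = hom G (mult_of F) \<inter> extensional (carrier G)"

definition ESC ::
    "('a, 'm) monoid_scheme \<Rightarrow> ('f, 'r) ring_scheme \<Rightarrow> 'j set \<Rightarrow>
      (('j \<Rightarrow> 'a) \<times> ('j \<Rightarrow> 'a \<Rightarrow> 'f)) set" where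
  "ESC G F J = (J \<rightarrow>\<^sub>E carrier G) \<times> (J \<rightarrow>\<^sub>E characters G F)"

definition ESC_isomorphic ::
    "('a, 'm) monoid_scheme \<Rightarrow> 'j set \<Rightarrow> ('j \<Rightarrow> 'a) \<times> ('j \<Rightarrow> 'a \<Rightarrow> 'f) \<Rightarrow>
     ('b, 'm2) monoid_scheme \<Rightarrow> 'k set \<Rightarrow> ('k \<Rightarrow> 'b) \<times> ('k \<Rightarrow> 'b \<Rightarrow> 'f) \<Rightarrow> bool" where
  "ESC_isomorphic G J X G' J' X' \<longleftrightarrow>
     (\<exists>\<phi> \<in> iso G G'. \<exists>\<sigma>. bij_betw \<sigma> J J' \<and>
        (\<forall>i\<in>J. \<phi> (fst X i) = fst X' (\<sigma> i) \<and>
               (\<forall>x\<in>carrier G. snd X' (\<sigma> i) (\<phi> x) = snd X i x)))"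

definition ESC_rel ::
    "('a, 'm) monoid_scheme \<Rightarrow> ('f, 'r) ring_scheme \<Rightarrow> 'j set \<Rightarrow>
      ((('j \<Rightarrow> 'a) \<times> ('j \<Rightarrow> 'a \<Rightarrow> 'f)) \<times> (('j \<Rightarrow> 'a) \<times> ('j \<Rightarrow> 'a \<Rightarrow> 'f))) set" where
  "ESC_rel G F J = {(X, Y). X \<in> ESC G F J \<and> Y \<in> ESC G F J \<and> ESC_isomorphic G J X G J Y}"

lemma equiv_ESC_rel:
  assumes "group G"
  shows "equiv (ESC G F J) (ESC_rel G F J)"
proof (rule equivI)
  interpret group G by fact
  show "ESC_rel G F J \<subseteq> ESC G F J \<times> ESC G F J"
    by (auto simp: ESC_rel_def)
  show "refl_on (ESC G F J) (ESC_rel G F J)"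
  proof (rule refl_onI)
    fix X assume "X \<in> ESC G F J"
    moreover have "ESC_isomorphic G J X G J X"
      unfolding ESC_isomorphic_def
      by (rule bexI[of _ id], rule exI[of _ id]) (auto simp: iso_def hom_def bij_betw_def)
    ultimately show "(X, X) \<in> ESC_rel G F J" by (simp add: ESC_rel_def)
  qed
  show "sym (ESC_rel G F J)"
  proof (rule symI)
    fix X Y assume XY: "(X, Y) \<in> ESC_rel G F J"
    then obtain f t where f: "f \<in> iso G G" and t: "bij_betw t J J"
      and g: "\<And>i. i \<in> J \<Longrightarrow> f (fst X i) = fst Y (t i)"
      and c: "\<And>i x. i \<in> J \<Longrightarrow> x \<in> carrier G \<Longrightarrow> snd Y (t i) (f x) = snd X i x"
      unfolding ESC_rel_def ESC_isomorphic_def by blast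
    let ?f = "inv_into (carrier G) f" and ?t = "inv_into J t"
    have bf: "bij_betw f (carrier G) (carrier G)" using f by (simp add: iso_def)
    have car: "fst X i \<in> carrier G" if "i \<in> J" for i
      using XY that by (auto simp: ESC_rel_def ESC_def)
    have 1: "?f \<in> iso G G" using f by (rule iso_set_sym)
    have 2: "bij_betw ?t J J" using t by (rule bij_betw_inv_into)
    have 3: "?f (fst Y j) = fst X (?t j)" if "j \<in> J" for j
    proof -
      have tj: "?t j \<in> J" "t (?t j) = j"
        using that t 2 by (auto simp: bij_betw_def f_inv_into_f)
      have "f (fst X (?t j)) = fst Y j" using g[OF tj(1)] tj(2) by simp
      then show ?thesis using bf car[OF tj(1)]
        by (metis bij_betw_inv_into_left)
    qed
    have 4: "snd X (?t j) (?f x) = snd Y j x" if "j \<in> J" "x \<in> carrier G" for j x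
    proof -
      have tj: "?t j \<in> J" "t (?t j) = j"
        using that t 2 by (auto simp: bij_betw_def f_inv_into_f)
      have fx: "?f x \<in> carrier G" "f (?f x) = x"
        using that bf by (auto simp: bij_betw_def f_inv_into_f inv_into_into)
      show ?thesis using c[OF tj(1) fx(1)] tj(2) fx(2) by simp
    qed
    have "ESC_isomorphic G J Y G J X"
      unfolding ESC_isomorphic_def using 1 2 3 4 by blast
    then show "(Y, X) \<in> ESC_rel G F J" using XY by (simp add: ESC_rel_def)
  qed
  show "trans (ESC_rel G F J)"
  proof (rule transI)
    fix X Y Z assume XY: "(X, Y) \<in> ESC_rel G F J" and YZ: "(Y, Z) \<in> ESC_rel G F J"
    obtain f t where f: "f \<in> iso G G" and t: "bij_betw t J J"
      and g: "\<And>i. i \<in> J \<Longrightarrow> f (fst X i) = fst Y (t i)"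
      and c: "\<And>i x. i \<in> J \<Longrightarrow> x \<in> carrier G \<Longrightarrow> snd Y (t i) (f x) = snd X i x"
      using XY unfolding ESC_rel_def ESC_isomorphic_def by blast
    obtain f' t' where f': "f' \<in> iso G G" and t': "bij_betw t' J J"
      and g': "\<And>i. i \<in> J \<Longrightarrow> f' (fst Y i) = fst Z (t' i)"
      and c': "\<And>i x. i \<in> J \<Longrightarrow> x \<in> carrier G \<Longrightarrow> snd Z (t' i) (f' x) = snd Y i x"
      using YZ unfolding ESC_rel_def ESC_isomorphic_def by blast
    have tJ: "t i \<in> J" if "i \<in> J" for i using t that by (auto simp: bij_betw_def)
    have fG: "f x \<in> carrier G" if "x \<in> carrier G" for x
      using f that by (auto simp: iso_def bij_betw_def)
    have 1: "f' \<circ> f \<in> iso G G" using f f' by (rule iso_set_trans)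
    have 2: "bij_betw (t' \<circ> t) J J" using t t' by (rule bij_betw_trans)
    have "ESC_isomorphic G J X G J Z"
      unfolding ESC_isomorphic_def
      by (rule bexI[OF _ 1], rule exI[of _ "t' \<circ> t"]) (auto simp: 2[unfolded comp_def] 2 g g' c c' tJ fG)
    then show "(X, Z) \<in> ESC_rel G F J" using XY YZ by (simp add: ESC_rel_def)
  qed
qed

(* The index set is {1..n}; isomorphism classes are taken among the ESCs over the fixed group G. *)
definition num_ESC_classes ::
    "('a, 'm) monoid_scheme \<Rightarrow> ('f, 'r) ring_scheme \<Rightarrow> nat \<Rightarrow> nat" where
  "num_ESC_classes G F n = card (ESC G F {1..n} // ESC_rel G F {1..n})"

definition GL :: "nat \<Rightarrow> 'k::field mat set" where
  "GL s = {A \<in> carrier_mat s s. invertible_mat A}"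

(* Tuples (l 1, ..., l n) are functions on {1..n} that are undefined elsewhere, so that each
   tuple occurs exactly once. *)
definition cycle_types :: "nat \<Rightarrow> (nat \<Rightarrow> nat) set" where
  "cycle_types n = {l \<in> {1..n} \<rightarrow>\<^sub>E UNIV. (\<Sum>i = 1..n. i * l i) = n}"

end

theory Submission
  imports Defs "HOL-Combinatorics.Cycles" "HOL-Algebra.Group_Action"
begin

text \<open>
  Write $V = \mathbb{Z}_p^s$. An identification of $G$ with $V$ and a $p$-th root of unity in $F$
  identify characters with vectors, so an ESC is an $n$-tuple in $V \times V$, on which
  $A \in GL(s,p)$ acts by $(v, w) \mapsto (Av, A^{-T}w)$. Forgetting the order of the tuple turns
  isomorphism classes into $GL(s,p)$-orbits on multisets of size $n$, which Burnside's lemma counts.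

  For a permutation $f$ of a finite set $W$ let $a_n$ be the number of $f$-invariant multisets of
  size $n$ and $c_k$ the number of fixed points of $f^k$. Removing $j$ copies of the $f$-orbit of $x$
  from an invariant multiset in which $x$ has multiplicity at least $j$ gives
  $n a_n = \sum_{k=1}^n c_k a_{n-k}$. The sum over cycle types satisfies the same recurrence, so no
  permutation has to be counted by its cycle type. Finally $c_k = p^{2(s - \mathrm{rank}(A^k - I))}$
  for the action of $A$, since a matrix and its transpose have kernels of the same size.
\<close>

subsection \<open>Multisets invariant under a permutation\<close>

text \<open>The recurrence is the coefficient form of t h'(t) = h(t) * (sum of c_k t^k) for h(t) =
  exp(sum of c_k t^k / k). Its coefficients are the cycle indices of the symmetric groups evaluated
  at c, which is the origin of the denominators \<open>fact (l i) * real i ^ l i\<close>. Working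
  with coefficients keeps every sum finite. Two facts make the translation to matrices exact. Since
  Z_p is a prime field, additive maps are linear, so the automorphisms of G are precisely the
  elements of GL(s,p). Since x^p = 1 for all x in G, a character takes values in the p-th roots of
  unity; a field has at most p of these, and the powers of one element of order p already provide p.
  Taking logarithms to that base turns a character into a linear form. The prefactor of the formula
  is 1/|GL(s,p)|, the divisor in Burnside's lemma; this order is found by counting ordered
  bases.\<close>

definition msets_of_size :: "'a set \<Rightarrow> nat \<Rightarrow> 'a multiset set" where
  "msets_of_size W n = {M. set_mset M \<subseteq> W \<and> size M = n}"

definition fixed_msets :: "('a \<Rightarrow> 'a) \<Rightarrow> 'a set \<Rightarrow> nat \<Rightarrow> 'a multiset set" where
  "fixed_msets f W n = {M \<in> msets_of_size W n. image_mset f M = M}"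

lemma finite_msets_of_size:
  assumes "finite W" shows "finite (msets_of_size W n)"
proof -
  have "msets_of_size W n \<subseteq> mset ` {xs. set xs \<subseteq> W \<and> length xs = n}"
  proof
    fix M assume M: "M \<in> msets_of_size W n"
    obtain xs where "mset xs = M" using ex_mset by blast
    then show "M \<in> mset ` {xs. set xs \<subseteq> W \<and> length xs = n}"
      using M by (intro image_eqI[of _ _ xs]) (auto simp: msets_of_size_def)
  qed
  then show ?thesis using finite_lists_length_eq[OF assms] by (meson finite_surj)
qed

text \<open>A bijection carries the multiplicity of x to that of f x. Invariance thus means that
  multiplicities are constant along the cycles of f.\<close>

lemma image_mset_fixed_iff:
  assumes "bij f"
  shows "image_mset f M = M \<longleftrightarrow> (\<forall>x. count M (f x) = count M x)"
proof -
  have *: "count (image_mset f M) (f x) = count M x" for x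
  proof -
    have "f -` {f x} \<inter> set_mset M = {x} \<inter> set_mset M"
      using assms by (auto simp: bij_def inj_def)
    then show ?thesis by (cases "x \<in># M") (auto simp: count_image_mset not_in_iff)
  qed
  show ?thesis
  proof
    assume "image_mset f M = M" then show "\<forall>x. count M (f x) = count M x" using * by metis
  next
    assume c: "\<forall>x. count M (f x) = count M x"
    show "image_mset f M = M"
    proof (rule multiset_eqI)
      fix y
      obtain x where "y = f x" using assms by (metis bij_pointE)
      then show "count (image_mset f M) y = count M y" using * c by simp
    qed
  qed
qed

text \<open>The multiplicity of x is the number of j \<ge> 1 that it reaches. For each such j the
  invariant multisets that reach it correspond to those of size n - j d, where d is the cycle length
  of x, and the numbers k = j d are the k with f^k x = x.\<close>

lemma sum_count_fixed_msets:
  assumes f: "f permutes W" and W: "finite W" and x: "x \<in> W"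
  shows "(\<Sum>M\<in>fixed_msets f W n. count M x) =
         (\<Sum>k\<in>{k\<in>{1..n}. (f ^^ k) x = x}. card (fixed_msets f W (n - k)))"
proof -
  let ?F = "fixed_msets f W"
  have perm: "permutation f" using f W by (auto simp: permutation_permutes)
  have bij: "bij f" using f by (rule permutes_bij)
  define d where "d = least_power f x"
  have d0: "d > 0" and fd: "(f ^^ d) x = x"
    using least_power_of_permutation[OF perm] by (auto simp: d_def)
  have dvd: "d dvd k \<longleftrightarrow> (f ^^ k) x = x" for k
    unfolding d_def by (rule least_power_dvd[OF perm])
  define S where "S = (\<lambda>i. (f ^^ i) x) ` {..<d}"
  have finS: "finite S" by (simp add: S_def)
  have xS: "x \<in> S" using d0 by (auto simp: S_def intro: image_eqI[of _ _ 0])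
  have cardS: "card S = d"
  proof -
    have "inj_on (\<lambda>i. (f ^^ i) x) {..<d}"
      using cycle_of_permutation[OF perm, of x]
      by (simp add: distinct_map d_def atLeast_upt)
    then show ?thesis by (simp add: S_def card_image)
  qed
  have SW: "S \<subseteq> W"
    using permutes_funpow[OF f] x by (auto simp: S_def permutes_in_image)
  have fS: "f ` S = S"
  proof (rule card_subset_eq[OF finS])
    show "f ` S \<subseteq> S"
    proof
      fix y assume "y \<in> f ` S"
      then obtain i where i: "i < d" "y = (f ^^ Suc i) x" by (auto simp: S_def)
      show "y \<in> S"
      proof (cases "Suc i = d")
        case True then show ?thesis using i fd xS by simp
      next
        case False then show ?thesis using i by (auto simp: S_def intro!: image_eqI[of _ _ "Suc i"])
      qed
    qed
    show "card (f ` S) = card S"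
      using bij by (intro card_image) (auto simp: bij_def inj_on_def)
  qed
  have fSiff: "f y \<in> S \<longleftrightarrow> y \<in> S" for y
    using fS bij by (metis bij_def inj_image_mem_iff)
  have const: "count M y = count M x" if "M \<in> ?F n" "y \<in> S" for M y n
  proof -
    have "count M ((f ^^ i) x) = count M x" for i
      using that image_mset_fixed_iff[OF bij, of M] by (induction i) (auto simp: fixed_msets_def)
    then show ?thesis using that by (auto simp: S_def)
  qed
  \<comment> \<open>The part to be removed: j copies of the whole cycle of x, itself invariant and
    of size j d.\<close>
  define Q where "Q j = repeat_mset j (mset_set S)" for j
  have cQ: "count (Q j) y = (if y \<in> S then j else 0)" for j y
    using finS by (simp add: Q_def count_mset_set')
  have Qset: "set_mset (Q j) \<subseteq> S" for j
    using cQ[of j] by (metis count_eq_zero_iff subsetI)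
  have Qsize: "size (Q j) = j * d" for j by (simp add: Q_def cardS)
  have sub: "Q j \<subseteq># M" if "M \<in> ?F n" "j \<le> count M x" for M j
    using const[OF that(1)] that(2) by (auto simp: subseteq_mset_def cQ)
  \<comment> \<open>The case distinction matters: for j d > n truncated subtraction would give size
    0, where one multiset exists, although the left side is 0.\<close>
  have level: "card {M \<in> ?F n. j \<le> count M x} = (if j * d \<le> n then card (?F (n - j * d)) else 0)" for j
  proof (cases "j * d \<le> n")
    case False
    have "{M \<in> ?F n. j \<le> count M x} = {}"
    proof (rule equals0I, clarify)
      fix M assume M: "M \<in> ?F n" "j \<le> count M x"
      then have "j * d \<le> size M" using size_mset_mono[OF sub[OF M]] by (simp add: Qsize)
      then show False using M(1) False by (simp add: fixed_msets_def msets_of_size_def)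
    qed
    then show ?thesis using False by (simp only: card.empty if_False)
  next
    case True
    have "bij_betw (\<lambda>M. M + Q j) (?F (n - j * d)) {M \<in> ?F n. j \<le> count M x}"
    proof (rule bij_betw_byWitness[where f' = "\<lambda>M. M - Q j"])
      show "(\<lambda>M. M + Q j) ` ?F (n - j * d) \<subseteq> {M \<in> ?F n. j \<le> count M x}"
        using True Qsize[of j] Qset[of j] SW xS
        by (auto simp: fixed_msets_def msets_of_size_def image_mset_fixed_iff[OF bij] cQ fSiff
              simp del: image_mset_union; blast)
      show "(\<lambda>M. M - Q j) ` {M \<in> ?F n. j \<le> count M x} \<subseteq> ?F (n - j * d)"
      proof clarify
        fix M assume M: "M \<in> ?F n" "j \<le> count M x"
        have "size (M - Q j) = n - j * d"
          using sub[OF M] M(1) Qsize[of j] by (simp add: size_Diff_submset fixed_msets_def msets_of_size_def)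
        moreover have "set_mset (M - Q j) \<subseteq> W"
          using M(1) by (auto simp: fixed_msets_def msets_of_size_def dest: in_diffD)
        ultimately show "M - Q j \<in> ?F (n - j * d)"
          using M(1) by (auto simp: fixed_msets_def msets_of_size_def image_mset_fixed_iff[OF bij] cQ fSiff)
      qed
    qed (use sub in auto)
    then show ?thesis using True by (simp add: bij_betw_same_card)
  qed
  have finF: "finite (?F n)" using finite_msets_of_size[OF W] by (simp add: fixed_msets_def)
  \<comment> \<open>Each multiplicity is split into unit layers; none exceeds the size n, so j runs
    through {1..n}.\<close>
  have "(\<Sum>M\<in>?F n. count M x) = (\<Sum>M\<in>?F n. \<Sum>j\<in>{1..n}. if j \<le> count M x then 1 else 0)"
  proof (rule sum.cong[OF refl])
    fix M assume "M \<in> ?F n"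
    then have "count M x \<le> n" by (auto simp: fixed_msets_def msets_of_size_def count_le_size)
    then have "{1..n} \<inter> {j. j \<le> count M x} = {1..count M x}" by auto
    then show "count M x = (\<Sum>j\<in>{1..n}. if j \<le> count M x then 1 else 0)"
      by (simp add: sum.If_cases)
  qed
  also have "\<dots> = (\<Sum>j\<in>{1..n}. \<Sum>M\<in>?F n. if j \<le> count M x then 1 else 0)" by (rule sum.swap)
  also have "\<dots> = (\<Sum>j\<in>{1..n}. card {M \<in> ?F n. j \<le> count M x})"
    using finF by (intro sum.cong) (auto simp: sum.If_cases Int_def)
  also have "\<dots> = (\<Sum>j\<in>{j\<in>{1..n}. j * d \<le> n}. card (?F (n - j * d)))"
    unfolding level by (simp only: sum.inter_filter finite_atLeastAtMost)
  also have "\<dots> = (\<Sum>k\<in>{k\<in>{1..n}. (f ^^ k) x = x}. card (?F (n - k)))"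
  proof (rule sum.reindex_bij_betw[of "\<lambda>j. j * d" _ _ "\<lambda>k. card (?F (n - k))"])
    show "bij_betw (\<lambda>j. j * d) {j \<in> {1..n}. j * d \<le> n} {k \<in> {1..n}. (f ^^ k) x = x}"
    proof (rule bij_betw_byWitness[where f' = "\<lambda>k. k div d"])
      show "(\<lambda>j. j * d) ` {j \<in> {1..n}. j * d \<le> n} \<subseteq> {k \<in> {1..n}. (f ^^ k) x = x}"
        using d0 by (auto simp flip: dvd)
      show "(\<lambda>k. k div d) ` {k \<in> {1..n}. (f ^^ k) x = x} \<subseteq> {j \<in> {1..n}. j * d \<le> n}"
        using d0 by (auto simp: Suc_le_eq div_greater_zero_iff dvd_imp_le simp flip: dvd
            intro: order.trans[OF div_le_dividend])
    qed (use d0 in \<open>auto simp flip: dvd\<close>)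
  qed
  finally show ?thesis .
qed

text \<open>Count the occurrences of points in invariant multisets twice: each multiset contributes
  its size n, each point the sum computed in \<open>sum_count_fixed_msets\<close>.\<close>

lemma fixed_msets_recurrence:
  assumes f: "f permutes W" and W: "finite W"
  shows "n * card (fixed_msets f W n) =
         (\<Sum>k=1..n. card {x \<in> W. (f ^^ k) x = x} * card (fixed_msets f W (n - k)))"
proof -
  let ?F = "fixed_msets f W"
  have "n * card (?F n) = (\<Sum>M\<in>?F n. \<Sum>x\<in>W. count M x)"
  proof -
    have "(\<Sum>x\<in>W. count M x) = n" if "M \<in> ?F n" for M
      using that W by (auto simp: fixed_msets_def msets_of_size_def size_multiset_overloaded_eq not_in_iff
          intro!: sum.mono_neutral_right)
    then show ?thesis by simp
  qed
  also have "\<dots> = (\<Sum>x\<in>W. \<Sum>M\<in>?F n. count M x)" by (rule sum.swap)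
  also have "\<dots> = (\<Sum>x\<in>W. \<Sum>k\<in>{k\<in>{1..n}. (f ^^ k) x = x}. card (?F (n - k)))"
    by (intro sum.cong refl sum_count_fixed_msets[OF f W])
  also have "\<dots> = (\<Sum>x\<in>W. \<Sum>k=1..n. if (f ^^ k) x = x then card (?F (n - k)) else 0)"
    by (simp only: sum.inter_filter finite_atLeastAtMost)
  also have "\<dots> = (\<Sum>k=1..n. \<Sum>x\<in>W. if (f ^^ k) x = x then card (?F (n - k)) else 0)"
    by (rule sum.swap)
  also have "\<dots> = (\<Sum>k=1..n. card {x \<in> W. (f ^^ k) x = x} * card (?F (n - k)))"
    using W by (intro sum.cong refl) (simp flip: sum.inter_filter)
  finally show ?thesis .
qed

section \<open>Cycle-type sums and their recurrence\<close>

text \<open>The bound \<open>N\<close> on the support is kept fixed so that the recurrence in \<open>n\<close> relates functions on the same domain.\<close>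
definition cycle_types_bounded :: "nat \<Rightarrow> nat \<Rightarrow> (nat \<Rightarrow> nat) set" where
  "cycle_types_bounded N n = {l \<in> {1..N} \<rightarrow>\<^sub>E UNIV. (\<Sum>i = 1..N. i * l i) = n}"

lemma finite_cycle_types_bounded: "finite (cycle_types_bounded N n)"
proof (rule finite_subset)
  show "cycle_types_bounded N n \<subseteq> {1..N} \<rightarrow>\<^sub>E {..n}"
  proof
    fix l assume l: "l \<in> cycle_types_bounded N n"
    have "l i \<le> n" if "i \<in> {1..N}" for i
    proof -
      have "l i \<le> i * l i" using that by simp
      also have "\<dots> \<le> (\<Sum>i = 1..N. i * l i)" using that by (intro member_le_sum) auto
      finally show ?thesis using l by (simp add: cycle_types_bounded_def)
    qed
    then show "l \<in> {1..N} \<rightarrow>\<^sub>E {..n}" using l by (auto simp: cycle_types_bounded_def PiE_iff)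
  qed
qed (auto intro: finite_PiE)

text \<open>The coefficient of t^n in exp(sum of c_k t^k / k over k \<le> N). For n \<le> N it is
  the cycle index of the symmetric group of degree n at c.\<close>

definition cycle_sum :: "(nat \<Rightarrow> real) \<Rightarrow> nat \<Rightarrow> nat \<Rightarrow> real" where
  "cycle_sum c N n = (\<Sum>l \<in> cycle_types_bounded N n. \<Prod>i = 1..N. c i ^ l i / (fact (l i) * real i ^ l i))"

lemma cycle_sum_0: "cycle_sum c N 0 = 1"
proof -
  have "cycle_types_bounded N 0 = {\<lambda>i\<in>{1..N}. 0}"
    by (auto simp: cycle_types_bounded_def PiE_iff extensional_def fun_eq_iff)
  then show ?thesis by (simp add: cycle_sum_def)
qed

text \<open>Weight the term of l by n, written as the sum of k * l k. For fixed k, lowering l k by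
  one absorbs the weight k * l k into the denominator and leaves c k times a term for n - k.\<close>

lemma cycle_sum_recurrence:
  assumes "n \<le> N"
  shows "real n * cycle_sum c N n = (\<Sum>k = 1..n. c k * cycle_sum c N (n - k))"
proof -
  let ?T = "cycle_types_bounded N"
  define t where "t l = (\<Prod>i = 1..N. c i ^ l i / (fact (l i) * real i ^ l i))" for l
  have shift: "(\<Sum>l\<in>?T n. real (k * l k) * t l) = (if k \<le> n then c k * cycle_sum c N (n - k) else 0)"
    if k: "k \<in> {1..N}" for k
  proof -
    have "(\<Sum>l\<in>?T n. real (k * l k) * t l) = (\<Sum>l\<in>{l\<in>?T n. l k > 0}. real (k * l k) * t l)"
      by (rule sum.mono_neutral_right) (auto simp: finite_cycle_types_bounded)
    also have "\<dots> = (if k \<le> n then c k * cycle_sum c N (n - k) else 0)"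
    proof (cases "k \<le> n")
      case False
      have "l k = 0" if "l \<in> ?T n" for l
      proof -
        have "k * l k \<le> (\<Sum>i = 1..N. i * l i)" using k by (intro member_le_sum) auto
        also have "\<dots> = n" using that by (simp add: cycle_types_bounded_def)
        finally show ?thesis using False by (cases "l k") auto
      qed
      then show ?thesis using False by (auto intro!: sum.neutral)
    next
      case True
      \<comment> \<open>Terms with l k = 0 carry weight 0, so only tuples in the image of
        \<open>up\<close> remain, and on these \<open>up\<close> can be undone.\<close>
      define up :: "(nat \<Rightarrow> nat) \<Rightarrow> nat \<Rightarrow> nat" where "up l = l(k := Suc (l k))" for l
      have sum_up: "(\<Sum>i = 1..N. i * up l i) = k + (\<Sum>i = 1..N. i * l i)" for l
      proof -
        have "(\<Sum>i\<in>{1..N} - {k}. i * up l i) = (\<Sum>i\<in>{1..N} - {k}. i * l i)"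
          by (intro sum.cong) (auto simp: up_def)
        then show ?thesis
          using sum.remove[of "{1..N}" k "\<lambda>i. i * up l i"] sum.remove[of "{1..N}" k "\<lambda>i. i * l i"] k
          by (simp add: up_def)
      qed
      \<comment> \<open>Raising l k to l k + 1 multiplies the term by c k / (k * (l k + 1)), whose
        denominator is exactly the weight.\<close>
      have t_up: "real (k * up l k) * t (up l) = c k * t l" for l
      proof -
        define u where "u i m = c i ^ m / (fact m * real i ^ m)" for i m
        have "(\<Prod>i\<in>{1..N} - {k}. u i (up l i)) = (\<Prod>i\<in>{1..N} - {k}. u i (l i))"
          by (intro prod.cong) (auto simp: up_def)
        moreover have "real (Suc (l k)) * real k * u k (Suc (l k)) = c k * u k (l k)"
          using k by (simp add: u_def divide_simps del: of_nat_Suc)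
        moreover have "t (up l) = u k (Suc (l k)) * (\<Prod>i\<in>{1..N} - {k}. u i (up l i))"
          using prod.remove[of "{1..N}" k "\<lambda>i. u i (up l i)"] k by (simp add: t_def u_def up_def)
        moreover have "t l = u k (l k) * (\<Prod>i\<in>{1..N} - {k}. u i (l i))"
          using prod.remove[of "{1..N}" k "\<lambda>i. u i (l i)"] k by (simp add: t_def u_def)
        moreover have "real (k * up l k) = real (Suc (l k)) * real k"
          by (simp add: up_def algebra_simps)
        ultimately show ?thesis
          by (simp only: mult.assoc[symmetric])
      qed
      have "(\<Sum>l\<in>{l\<in>?T n. l k > 0}. real (k * l k) * t l) = (\<Sum>l\<in>?T (n - k). real (k * up l k) * t (up l))"
      proof (rule sum.reindex_bij_betw[symmetric, of up _ _ "\<lambda>l. real (k * l k) * t l"])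
        show "bij_betw up (?T (n - k)) {l \<in> ?T n. 0 < l k}"
        proof (rule bij_betw_byWitness[where f' = "\<lambda>l. l(k := l k - 1)"])
          show "up ` ?T (n - k) \<subseteq> {l \<in> ?T n. 0 < l k}"
            using k True sum_up
            by (auto simp: cycle_types_bounded_def PiE_iff extensional_def) (auto simp: up_def)
          show "(\<lambda>l. l(k := l k - 1)) ` {l \<in> ?T n. 0 < l k} \<subseteq> ?T (n - k)"
          proof clarify
            fix l assume l: "l \<in> ?T n" "0 < l k"
            have "up (l(k := l k - 1)) = l" using l by (auto simp: up_def)
            note sum_up[of "l(k := l k - 1)", unfolded this]
            then have "(\<Sum>i = 1..N. i * (l(k := l k - 1)) i) = n - k"
              using l(1)
              unfolding cycle_types_bounded_def mem_Collect_eq by linarith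
            then show "l(k := l k - 1) \<in> ?T (n - k)"
              using l k by (auto simp: cycle_types_bounded_def PiE_iff extensional_def)
          qed
        qed (auto simp: up_def)
      qed
      also have "\<dots> = c k * cycle_sum c N (n - k)"
        unfolding t_up by (simp add: cycle_sum_def sum_distrib_left t_def)
      finally show ?thesis using True by simp
    qed
    finally show ?thesis .
  qed
  have "real n * cycle_sum c N n = (\<Sum>l\<in>?T n. real (\<Sum>k = 1..N. k * l k) * t l)"
    by (simp add: cycle_sum_def t_def sum_distrib_left cycle_types_bounded_def)
  also have "\<dots> = (\<Sum>k = 1..N. \<Sum>l\<in>?T n. real (k * l k) * t l)"
    by (subst sum.swap) (simp add: sum_distrib_right)
  also have "\<dots> = (\<Sum>k = 1..N. if k \<le> n then c k * cycle_sum c N (n - k) else 0)"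
    by (intro sum.cong refl shift)
  \<comment> \<open>Here n \<le> N enters: every k \<le> n lies in the range {1..N}, and the
    remaining k contribute 0.\<close>
  also have "\<dots> = (\<Sum>k = 1..n. c k * cycle_sum c N (n - k))"
    using assms by (intro sum.mono_neutral_cong_right) auto
  finally show ?thesis .
qed

text \<open>Both sides are 1 at n = 0. For n > 0 the common recurrence determines n times the value
  from smaller indices, and n can be cancelled.\<close>

lemma card_fixed_msets:
  assumes f: "f permutes W" and W: "finite W" and "n \<le> N"
  shows "real (card (fixed_msets f W n)) = cycle_sum (\<lambda>k. real (card {x \<in> W. (f ^^ k) x = x})) N n"
  using \<open>n \<le> N\<close>
proof (induction n rule: less_induct)
  case (less n)
  let ?c = "\<lambda>k. real (card {x \<in> W. (f ^^ k) x = x})"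
  show ?case
  proof (cases "n = 0")
    case True
    have "fixed_msets f W 0 = {{#}}" by (auto simp: fixed_msets_def msets_of_size_def)
    then show ?thesis using True by (simp add: cycle_sum_0)
  next
    case False
    have "real n * real (card (fixed_msets f W n)) = (\<Sum>k = 1..n. ?c k * real (card (fixed_msets f W (n - k))))"
      using fixed_msets_recurrence[OF f W, of n] by (simp flip: of_nat_mult of_nat_sum)
    also have "\<dots> = (\<Sum>k = 1..n. ?c k * cycle_sum ?c N (n - k))"
      using less False by (intro sum.cong refl) auto
    also have "\<dots> = real n * cycle_sum ?c N n"
      by (rule cycle_sum_recurrence[OF less.prems, symmetric])
    finally show ?thesis using False by simp
  qed
qed

subsection \<open>Counting over a finite field\<close>

lemma card_carrier_vec: "card (carrier_vec n :: 'k::finite vec set) = CARD('k) ^ n"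
proof -
  have "bij_betw (vec n) ({..<n} \<rightarrow>\<^sub>E (UNIV :: 'k set)) (carrier_vec n)"
  proof (rule bij_betw_byWitness[where f' = "\<lambda>v. \<lambda>i\<in>{..<n}. v $ i"])
    show "\<forall>f\<in>{..<n} \<rightarrow>\<^sub>E UNIV. (\<lambda>i\<in>{..<n}. vec n f $ i) = (f :: nat \<Rightarrow> 'k)"
      by (auto simp: PiE_iff extensional_def fun_eq_iff)
    show "\<forall>v\<in>carrier_vec n. vec n (\<lambda>i\<in>{..<n}. v $ i) = (v :: 'k vec)"
      by (intro ballI eq_vecI) simp_all
  qed (simp_all add: image_subset_iff)
  from bij_betw_same_card[OF this] show ?thesis by (simp add: card_PiE)
qed

lemma finite_carrier_vec [simp]: "finite (carrier_vec n :: 'k::finite vec set)"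
  by (rule card_ge_0_finite) (simp add: card_carrier_vec)

text \<open>The fibre over each point of the image is a translate of the kernel.\<close>

lemma card_image_mult_card_kernel:
  fixes A :: "'k::{field,finite} mat"
  assumes A: "A \<in> carrier_mat m n"
  shows "card ((\<lambda>v. A *\<^sub>v v) ` carrier_vec n) * card {v \<in> carrier_vec n. A *\<^sub>v v = 0\<^sub>v m} = CARD('k) ^ n"
proof -
  let ?f = "\<lambda>v. A *\<^sub>v v" and ?V = "carrier_vec n :: 'k vec set"
  let ?K = "{v \<in> ?V. ?f v = 0\<^sub>v m}"
  have fib: "card {v \<in> ?V. ?f v = y} = card ?K" if y: "y \<in> ?f ` ?V" for y
  proof -
    obtain v0 where v0: "v0 \<in> ?V" "y = ?f v0" using y by blast
    have "bij_betw (\<lambda>v. v + v0) ?K {v \<in> ?V. ?f v = y}"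
    proof (rule bij_betw_byWitness[where f' = "\<lambda>v. v - v0"])
      show "(\<lambda>v. v + v0) ` ?K \<subseteq> {v \<in> ?V. ?f v = y}"
        using v0 A by (auto simp: mult_add_distrib_mat_vec[OF A])
      show "(\<lambda>v. v - v0) ` {v \<in> ?V. ?f v = y} \<subseteq> ?K"
        using v0 A by (auto simp: mult_minus_distrib_mat_vec[OF A])
    qed (use v0 in auto)
    then show ?thesis by (simp add: bij_betw_same_card)
  qed
  have "CARD('k) ^ n = card (\<Union>y\<in>?f ` ?V. {v \<in> ?V. ?f v = y})"
    by (subst card_carrier_vec[symmetric]) (rule arg_cong[of _ _ card], auto)
  also have "\<dots> = (\<Sum>y\<in>?f ` ?V. card {v \<in> ?V. ?f v = y})"
    by (rule card_UN_disjoint) auto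
  also have "\<dots> = card (?f ` ?V) * card ?K" using fib by simp
  finally show ?thesis by simp
qed

text \<open>By independence, coefficient families on S correspond one to one to vectors of the span.
  Taking them extensional on S counts each family once.\<close>

lemma (in vec_space) card_span_lin_indpt:
  assumes "finite S" "S \<subseteq> carrier_vec n" "lin_indpt S"
  shows "card (span S) = CARD('a) ^ card S"
proof -
  have inj: "inj_on (\<lambda>a. lincomb a S) (S \<rightarrow>\<^sub>E UNIV)"
  proof (rule inj_onI)
    fix a b assume a: "a \<in> S \<rightarrow>\<^sub>E UNIV" and b: "b \<in> S \<rightarrow>\<^sub>E UNIV" and eq: "lincomb a S = lincomb b S"
    have "lincomb (\<lambda>v. a v - b v) S = 0\<^sub>v n"
    proof (rule eq_vecI)
      fix i assume "i < dim_vec (0\<^sub>v n :: 'a vec)"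
      then have i: "i < n" by simp
      have "lincomb (\<lambda>v. a v - b v) S $ i = lincomb a S $ i - lincomb b S $ i"
        unfolding lincomb_index[OF i assms(2)] by (simp add: left_diff_distrib sum_subtractf)
      then show "lincomb (\<lambda>v. a v - b v) S $ i = 0\<^sub>v n $ i" using eq i by simp
    qed (use lincomb_dim[OF assms(1,2)] in simp)
    then have "(\<lambda>v. a v - b v) \<in> S \<rightarrow> {0}"
      by (intro not_lindepD[OF assms(3,1)]) auto
    then show "a = b" using a b by (intro PiE_ext[OF a b]) (auto simp: Pi_iff)
  qed
  have "span S = (\<lambda>a. lincomb a S) ` (S \<rightarrow>\<^sub>E UNIV)"
  proof -
    have "lincomb a S \<in> (\<lambda>a. lincomb a S) ` (S \<rightarrow>\<^sub>E UNIV)" for a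
      using lincomb_cong[OF refl assms(2), of a "restrict a S"]
      by (intro image_eqI[of _ _ "restrict a S"]) auto
    then show ?thesis unfolding finite_span[OF assms(1,2)] by auto
  qed
  then have "card (span S) = card (S \<rightarrow>\<^sub>E (UNIV :: 'a set))" using inj by (simp add: card_image)
  also have "\<dots> = CARD('a) ^ card S" using assms by (simp add: card_PiE)
  finally show ?thesis .
qed

text \<open>The image is the column space. A maximal independent set of columns spans it and has as
  many elements as the rank.\<close>

lemma (in vec_space) card_image_mult_mat_vec:
  assumes A: "A \<in> carrier_mat n m"
  shows "card ((\<lambda>v. A *\<^sub>v v) ` carrier_vec m) = CARD('a) ^ rank A"
proof -
  have cols: "set (cols A) \<subseteq> carrier_vec n" using A cols_dim by blast
  have "\<exists>U. finite U \<and> maximal U (\<lambda>T. T \<subseteq> set (cols A) \<and> lin_indpt T) \<and> {} \<subseteq> U"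
    by (rule maximal_exists_superset[of "set (cols A)"]) (auto simp: lin_dep_def)
  then obtain U where finU: "finite U" and max: "maximal U (\<lambda>T. T \<subseteq> set (cols A) \<and> lin_indpt T)"
    by blast
  have U: "U \<subseteq> set (cols A)" "lin_indpt U" using max by (auto simp: maximal_def)
  have "set (cols A) \<subseteq> span U"
  proof
    fix s assume s: "s \<in> set (cols A)"
    show "s \<in> span U"
    proof (cases "s \<in> U")
      case True then show ?thesis using U cols by (meson in_own_span subset_iff subset_trans)
    next
      case False
      \<comment> \<open>A column outside U would enlarge U, so maximality makes it dependent on U
        and places it in the span.\<close>
      then have "\<not> lin_indpt (U \<union> {s})" using max s U unfolding maximal_def by blast
      then show ?thesis using lin_dep_iff_in_span[of U s] False U cols s by auto
    qed
  qed
  then have "span (set (cols A)) = span U"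
    using U cols by (meson span_is_monotone span_subsetI subset_antisym subset_trans)
  moreover have "(\<lambda>v. A *\<^sub>v v) ` carrier_vec m = span (set (cols A))"
    using col_space_eq[OF A] A by (auto simp: col_space_def)
  ultimately show ?thesis
    using card_span_lin_indpt[OF finU _ U(2)] U(1) cols rank_card_indpt[OF A max] by auto
qed

lemma card_mat_kernel:
  fixes A :: "'k::{field,finite} mat"
  assumes A: "A \<in> carrier_mat n n"
  shows "card {v \<in> carrier_vec n. A *\<^sub>v v = 0\<^sub>v n} = CARD('k) ^ (n - vec_space.rank n A)"
proof -
  interpret vec_space "TYPE('k)" n .
  have "CARD('k) ^ rank A * card {v \<in> carrier_vec n. A *\<^sub>v v = 0\<^sub>v n} = CARD('k) ^ rank A * CARD('k) ^ (n - rank A)"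
    using card_image_mult_card_kernel[OF A] card_image_mult_mat_vec[OF A] rank_le_nc[OF A]
    by (simp flip: power_add)
  then show ?thesis by simp
qed

text \<open>For u nonzero the map w to w \<bullet> u is onto the field, so its kernel has q^n / q
  elements. Multiplying by q avoids the exponent n - 1.\<close>

lemma card_orthogonal_vec:
  fixes u :: "'k::{field,finite} vec"
  assumes u: "u \<in> carrier_vec n"
  shows "CARD('k) * card {w \<in> carrier_vec n. w \<bullet> u = 0} =
         (if u = 0\<^sub>v n then CARD('k) * CARD('k) ^ n else CARD('k) ^ n)"
proof (cases "u = 0\<^sub>v n")
  case True
  then have "{w \<in> carrier_vec n. w \<bullet> u = 0} = carrier_vec n" by auto
  then show ?thesis using True by (simp add: card_carrier_vec)
next
  case False
  \<comment> \<open>The linear form is treated as a matrix with one row, so that the count of image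
    and kernel applies.\<close>
  let ?A = "mat_of_rows n [u]"
  have A: "?A \<in> carrier_mat 1 n" using mat_of_rows_carrier(1)[of n "[u]"] by simp
  have Av: "?A *\<^sub>v w = vec 1 (\<lambda>_. w \<bullet> u)" if "w \<in> carrier_vec n" for w
    using that u by (intro eq_vecI) (auto simp: comm_scalar_prod)
  obtain i where i: "i < n" "u $ i \<noteq> 0" using False u by (metis carrier_vecD eq_vecI index_zero_vec)
  have "(\<lambda>v. ?A *\<^sub>v v) ` carrier_vec n = carrier_vec 1"
  proof
    show "carrier_vec 1 \<subseteq> (\<lambda>v. ?A *\<^sub>v v) ` carrier_vec n"
    proof
      fix y :: "'k vec" assume y: "y \<in> carrier_vec 1"
      \<comment> \<open>A preimage of y along one coordinate: dividing by a nonzero entry of u makes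
        the scalar product equal to y $ 0.\<close>
      let ?w = "(y $ 0 / u $ i) \<cdot>\<^sub>v unit_vec n i"
      have "?w \<bullet> u = y $ 0" using i u by simp
      then have "?A *\<^sub>v ?w = y" using y by (subst Av) (auto intro!: eq_vecI)
      then show "y \<in> (\<lambda>v. ?A *\<^sub>v v) ` carrier_vec n" by (intro image_eqI[of _ _ ?w]) auto
    qed
  qed (use A in auto)
  moreover have "{v \<in> carrier_vec n. ?A *\<^sub>v v = 0\<^sub>v 1} = {w \<in> carrier_vec n. w \<bullet> u = 0}"
    using Av by (auto simp: vec_eq_iff)
  ultimately show ?thesis
    using card_image_mult_card_kernel[OF A] False by (simp add: card_carrier_vec)
qed

text \<open>Both kernels are read off from the number of pairs with \<open>w \<bullet> A v = 0\<close>, which is symmetric in \<open>A\<close> and its transpose.\<close>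
lemma card_mat_kernel_transpose:
  fixes A :: "'k::{field,finite} mat"
  assumes A: "A \<in> carrier_mat n n"
  shows "card {v \<in> carrier_vec n. A\<^sup>T *\<^sub>v v = 0\<^sub>v n} = card {v \<in> carrier_vec n. A *\<^sub>v v = 0\<^sub>v n}"
proof -
  define q where "q = CARD('k)"
  have q: "q > 1" using card_mono[of UNIV "{0, 1 :: 'k}"] by (simp add: q_def)
  define pairs where "pairs B = {(v, w) \<in> carrier_vec n \<times> carrier_vec n. w \<bullet> (B *\<^sub>v v) = (0::'k)}" for B
  define ker where "ker B = card {v \<in> carrier_vec n. B *\<^sub>v v = (0\<^sub>v n :: 'k vec)}" for B
  \<comment> \<open>After multiplication by q every v contributes q^n, and each v in the kernel an
    extra (q - 1) q^n. Since q > 1, the kernel size can be recovered from the number of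
    pairs.\<close>
  have count: "q * card (pairs B) = q ^ n * (q ^ n + (q - 1) * ker B)" if B: "B \<in> carrier_mat n n" for B
  proof -
    let ?V = "carrier_vec n :: 'k vec set"
    have "pairs B = Sigma ?V (\<lambda>v. {w \<in> ?V. w \<bullet> (B *\<^sub>v v) = 0})" by (auto simp: pairs_def)
    then have "q * card (pairs B) = (\<Sum>v\<in>?V. q * card {w \<in> ?V. w \<bullet> (B *\<^sub>v v) = 0})"
      by (simp add: card_SigmaI sum_distrib_left)
    also have "\<dots> = (\<Sum>v\<in>?V. q ^ n + (if B *\<^sub>v v = 0\<^sub>v n then (q - 1) * q ^ n else 0))"
    proof (rule sum.cong[OF refl])
      fix v assume "v \<in> ?V"
      then have "B *\<^sub>v v \<in> ?V" using B by simp
      from card_orthogonal_vec[OF this, folded q_def]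
      show "q * card {w \<in> ?V. w \<bullet> (B *\<^sub>v v) = 0} = q ^ n + (if B *\<^sub>v v = 0\<^sub>v n then (q - 1) * q ^ n else 0)"
        using q by (simp add: mult_eq_if)
    qed
    also have "\<dots> = q ^ n * q ^ n + (\<Sum>v\<in>{v\<in>?V. B *\<^sub>v v = 0\<^sub>v n}. (q - 1) * q ^ n)"
      by (simp only: sum.distrib sum.inter_filter[OF finite_carrier_vec]) (simp add: card_carrier_vec q_def)
    finally show ?thesis by (simp add: ker_def algebra_simps)
  qed
  have "pairs A\<^sup>T = prod.swap ` pairs A"
  proof -
    have "w \<bullet> (A\<^sup>T *\<^sub>v v) = v \<bullet> (A *\<^sub>v w)" if "v \<in> carrier_vec n" "w \<in> carrier_vec n" for v w
      using transpose_vec_mult_scalar[OF A that(2,1)] that A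
      by (metis comm_scalar_prod mult_mat_vec_carrier transpose_carrier_mat)
    then show ?thesis by (force simp: pairs_def image_iff)
  qed
  then have "card (pairs A\<^sup>T) = card (pairs A)" by (simp add: card_image)
  then have "q ^ n * (q ^ n + (q - 1) * ker A\<^sup>T) = q ^ n * (q ^ n + (q - 1) * ker A)"
    using count[OF A] count[of "A\<^sup>T"] A by (metis transpose_carrier_mat)
  then show ?thesis using q by (simp add: ker_def)
qed

section \<open>The order of the general linear group\<close>

lemma GL_eq_Units: "GL n = Units (ring_mat TYPE('k::field) n b)"
proof -
  have "\<exists>B\<in>carrier_mat n n. B * A = 1\<^sub>m n \<and> A * B = 1\<^sub>m n"
    if A: "A \<in> carrier_mat n n" and B: "A * B = 1\<^sub>m n" "B * A = 1\<^sub>m (dim_row B)" for A B :: "'k mat"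
  proof -
    \<comment> \<open>\<open>invertible_mat\<close> does not state the dimensions of the inverse;
      they follow by comparing columns in the two product equations.\<close>
    have "dim_col (A * B) = dim_col (1\<^sub>m n :: 'k mat)" "dim_col (B * A) = dim_col (1\<^sub>m (dim_row B) :: 'k mat)"
      using B by simp_all
    then have "B \<in> carrier_mat n n" using A by (intro carrier_matI) simp_all
    then show ?thesis using B by auto
  qed
  then show ?thesis
    by (auto simp: GL_def Units_def ring_mat_simps invertible_mat_def inverts_mat_def)
qed

lemma GL_eq_det: "GL n = {A \<in> carrier_mat n n. det A \<noteq> (0 :: 'k::field)}"
proof -
  have "A \<in> carrier_mat n n" if "A \<in> GL n" for A :: "'k mat" using that by (simp add: GL_def)
  then show ?thesis
    using det_non_zero_imp_unit[of _ n "()"] unit_imp_det_non_zero[of _ n "()"]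
    unfolding GL_eq_Units[of n "()"] by blast
qed

text \<open>Lists rather than sets, because the columns of a matrix are ordered. Distinctness is
  demanded separately, as \<open>set vs\<close> would hide a repeated column.\<close>

definition (in vec_space) indep_lists :: "nat \<Rightarrow> 'a vec list set" where
  "indep_lists k = {vs. length vs = k \<and> distinct vs \<and> set vs \<subseteq> carrier_vec n \<and> lin_indpt (set vs)}"

text \<open>A list of i independent vectors is extended by any vector outside its span, and that
  span has q^i elements.\<close>

lemma card_indep_lists:
  "card (vec_space.indep_lists n k :: 'k::{field,finite} vec list set) = (\<Prod>i<k. CARD('k) ^ n - CARD('k) ^ i)"
proof (induction k)
  case 0
  interpret vec_space "TYPE('k)" n .
  have "indep_lists 0 = {[]}" by (auto simp: indep_lists_def lin_dep_def)
  then show ?case by simp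
next
  case (Suc k)
  interpret vec_space "TYPE('k)" n .
  have fin: "finite (indep_lists k)"
    by (rule finite_subset[OF _ finite_lists_length_eq[of "carrier_vec n" k]]) (auto simp: indep_lists_def)
  have eq: "indep_lists (Suc k) = (\<lambda>(vs, v). v # vs) ` Sigma (indep_lists k) (\<lambda>vs. carrier_vec n - span (set vs))"
  proof (intro equalityI subsetI)
    fix us assume us: "us \<in> indep_lists (Suc k)"
    then obtain v vs where [simp]: "us = v # vs" by (cases us) (auto simp: indep_lists_def)
    have vs: "set vs \<subseteq> carrier_vec n" "v \<notin> set vs" "v \<in> carrier_vec n" "lin_indpt (insert v (set vs))"
      using us by (auto simp: indep_lists_def)
    have "lin_indpt (set vs)" using vs subset_li_is_li by blast
    then have "v \<notin> span (set vs)" using lin_dep_iff_in_span[of "set vs" v] vs by auto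
    then show "us \<in> (\<lambda>(vs, v). v # vs) ` Sigma (indep_lists k) (\<lambda>vs. carrier_vec n - span (set vs))"
      using us \<open>lin_indpt (set vs)\<close> by (intro image_eqI[of _ _ "(vs, v)"]) (auto simp: indep_lists_def)
  next
    fix us assume "us \<in> (\<lambda>(vs, v). v # vs) ` Sigma (indep_lists k) (\<lambda>vs. carrier_vec n - span (set vs))"
    then obtain v vs where us: "us = v # vs" "vs \<in> indep_lists k" "v \<in> carrier_vec n" "v \<notin> span (set vs)"
      by auto
    then have "v \<notin> set vs" using in_own_span[of "set vs"] by (auto simp: indep_lists_def)
    then show "us \<in> indep_lists (Suc k)"
      using us lin_dep_iff_in_span[of "set vs" v] by (auto simp: indep_lists_def)
  qed
  have "card (carrier_vec n - span (set vs)) = CARD('k) ^ n - CARD('k) ^ k" if "vs \<in> indep_lists k" for vs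
  proof -
    have vs: "set vs \<subseteq> carrier_vec n" "lin_indpt (set vs)" "card (set vs) = k"
      using that distinct_card[of vs] by (auto simp: indep_lists_def)
    have "span (set vs) \<subseteq> carrier_vec n" using span_closed[OF vs(1)] by auto
    then show ?thesis
      using card_span_lin_indpt[OF _ vs(1,2)] vs(3)
      by (simp add: card_Diff_subset finite_subset[OF _ finite_carrier_vec] card_carrier_vec)
  qed
  then have "card (indep_lists (Suc k)) = card (indep_lists k) * (CARD('k) ^ n - CARD('k) ^ k)"
    unfolding eq by (subst card_image) (auto simp: inj_on_def fin)
  then show ?case using Suc by simp
qed

text \<open>Invertible matrices are those of full rank, that is, with independent columns, so
  \<open>cols\<close> matches them with ordered bases.\<close>

lemma card_GL: "card (GL n :: 'k::{field,finite} mat set) = (\<Prod>i<n. CARD('k) ^ n - CARD('k) ^ i)"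
proof -
  interpret vec_space "TYPE('k)" n .
  have "bij_betw cols (GL n) (indep_lists n)"
  proof (rule bij_betw_byWitness[where f' = "mat_of_cols n"])
    show "cols ` GL n \<subseteq> indep_lists n"
    proof clarify
      fix A :: "'k mat" assume "A \<in> GL n"
      then have A: "A \<in> carrier_mat n n" and "rank A = n" using det_rank_iff by (auto simp: GL_eq_det)
      moreover have "distinct (cols A)" using non_distinct_low_rank[OF A] \<open>rank A = n\<close> by auto
      ultimately show "cols A \<in> indep_lists n"
        using full_rank_lin_indpt[OF A] cols_dim[of A] by (auto simp: indep_lists_def)
    qed
    show "mat_of_cols n ` indep_lists n \<subseteq> GL n"
    proof clarify
      fix vs assume vs: "vs \<in> indep_lists n"
      have A: "mat_of_cols n vs \<in> carrier_mat n n" "cols (mat_of_cols n vs) = vs"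
        using vs by (auto simp: indep_lists_def)
      then have "rank (mat_of_cols n vs) = n" using vs by (intro lin_indpt_full_rank) (auto simp: indep_lists_def)
      then show "mat_of_cols n vs \<in> GL n" using A det_rank_iff by (auto simp: GL_eq_det)
    qed
  qed (auto simp: GL_def indep_lists_def intro!: mat_of_cols_cols)
  then show ?thesis using card_indep_lists[of n n, where 'k = 'k] by (simp add: bij_betw_same_card)
qed

text \<open>Taking q^i out of the factor q^n - q^i produces the exponent 0 + 1 + ... + (n - 1), and
  reversing the order of the remaining factors gives the product.\<close>

lemma card_GL_real:
  "real (card (GL n :: 'k::{field,finite} mat set)) =
    real CARD('k) ^ (n * (n - 1) div 2) * (\<Prod>i = 1..n. real CARD('k) ^ i - 1)"
proof -
  let ?q = "real CARD('k)"
  have "real (card (GL n :: 'k mat set)) = (\<Prod>i<n. ?q ^ n - ?q ^ i)"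
    unfolding card_GL of_nat_prod by (intro prod.cong refl) (simp add: of_nat_diff power_increasing)
  also have "\<dots> = (\<Prod>i<n. ?q ^ i * (?q ^ (n - i) - 1))"
    by (intro prod.cong refl) (simp add: right_diff_distrib flip: power_add)
  also have "\<dots> = (\<Prod>i<n. ?q ^ i) * (\<Prod>i<n. ?q ^ (n - i) - 1)"
    by (rule prod.distrib)
  also have "(\<Prod>i<n. ?q ^ i) = ?q ^ (\<Sum>i<n. i)" by (rule power_sum[symmetric])
  also have "(\<Sum>i<n. i) = n * (n - 1) div 2"
    using Sum_Ico_nat[of 0 n] by (simp add: atLeast0LessThan)
  also have "(\<Prod>i<n. ?q ^ (n - i) - 1) = (\<Prod>i = 1..n. ?q ^ i - 1)"
    by (rule prod.reindex_bij_witness[of _ "\<lambda>i. n - i" "\<lambda>i. n - i"]) auto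
  finally show ?thesis .
qed

subsection \<open>Characters of an elementary abelian group\<close>

text \<open>Divide by X - a for one root a. The remainder is the value at a, hence 0; in a domain
  the other roots must be roots of the quotient, whose degree is one less.\<close>

lemma (in UP_domain) card_roots_le_deg:
  assumes "finite S" "S \<subseteq> carrier R" "f \<in> carrier P" "f \<noteq> \<zero>\<^bsub>P\<^esub>"
    and "\<And>a. a \<in> S \<Longrightarrow> eval R R id a f = \<zero>"
  shows "card S \<le> deg R f"
  using assms
proof (induction S arbitrary: f rule: finite_induct)
  case empty
  then show ?case by simp
next
  case (insert a S)
  have a: "a \<in> carrier R" and fa: "eval R R id a f = \<zero>" using insert.prems by blast+
  have nontriv: "carrier R \<noteq> {\<zero>}" by (metis R.one_zeroI R.zero_not_one)
  let ?g = "monom P \<one> 1 \<ominus>\<^bsub>P\<^esub> monom P a 0"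
  obtain q where q: "q \<in> carrier P" and "f = ?g \<otimes>\<^bsub>P\<^esub> q \<oplus>\<^bsub>P\<^esub> monom P (eval R R id a f) 0"
    using remainder_theorem[OF insert.prems(2) a nontriv] by auto
  then have f: "f = ?g \<otimes>\<^bsub>P\<^esub> q" using a by (simp add: fa)
  have dg: "deg R ?g = 1" using a by (simp add: deg_minus_eq)
  have g0: "?g \<noteq> \<zero>\<^bsub>P\<^esub>" using dg by (metis deg_zero zero_neq_one)
  have q0: "q \<noteq> \<zero>\<^bsub>P\<^esub>" using insert.prems(3) a f by auto
  have "eval R R id b q = \<zero>" if "b \<in> S" for b
  proof -
    have b: "b \<in> carrier R" "b \<noteq> a" using that insert by auto
    have "eval R R id b f = \<zero>" using insert.prems(4)[of b] that by blast
    then have "eval R R id b (?g \<otimes>\<^bsub>P\<^esub> q) = \<zero>" by (simp only: f[symmetric])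
    then have "(b \<ominus> a) \<otimes> eval R R id b q = \<zero>"
      using a b q by (simp add: evalRR_simps del: One_nat_def)
    moreover have "eval R R id b q \<in> carrier R" using b q by (simp add: carrier_evalRR)
    ultimately show ?thesis using a b by (auto simp: R.integral_iff)
  qed
  then have "card S \<le> deg R q" using insert.IH[of q] insert.prems(1) q q0 by blast
  moreover have "deg R f = 1 + deg R q" unfolding f using deg_mult[OF g0 q0 _ q] a dg by simp
  ultimately show ?case using insert.hyps by simp
qed

lemma (in domain) card_roots_of_unity_le:
  fixes d :: nat
  assumes "finite S" "S \<subseteq> {x \<in> carrier R. x [^] d = \<one>}" "d \<noteq> 0"
  shows "card S \<le> d"
proof -
  interpret UP: UP_domain R "UP R" by unfold_locales simp
  let ?f = "monom (UP R) \<one> d \<ominus>\<^bsub>UP R\<^esub> monom (UP R) \<one> 0"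
  have deg: "deg R ?f = d" using assms(3) by (simp add: UP.deg_minus_eq)
  have "?f \<noteq> \<zero>\<^bsub>UP R\<^esub>" using deg assms(3) by (metis UP.deg_zero)
  then have "card S \<le> deg R ?f"
    using assms by (intro UP.card_roots_le_deg) (auto simp: UP.evalRR_simps)
  then show ?thesis by (simp only: deg)
qed

section \<open>Additive maps over a prime field\<close>

text \<open>Every scalar in Z_p is the image of a natural number, so scaling is repeated
  addition.\<close>

lemma additive_mod_ring_scale:
  fixes L :: "'p::prime_card mod_ring vec \<Rightarrow> 'p mod_ring"
  assumes add: "\<And>u v. u \<in> carrier_vec n \<Longrightarrow> v \<in> carrier_vec n \<Longrightarrow> L (u + v) = L u + L v"
    and v: "v \<in> carrier_vec n"
  shows "L (c \<cdot>\<^sub>v v) = c * L v"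
proof -
  have L0: "L (0\<^sub>v n) = 0" using add[of "0\<^sub>v n" "0\<^sub>v n"]
    by (metis add_cancel_right_right left_zero_vec zero_carrier_vec)
  have "L (of_nat k \<cdot>\<^sub>v v) = of_nat k * L v" for k
  proof (induction k)
    case 0
    have "0 \<cdot>\<^sub>v v = 0\<^sub>v n" using v by auto
    then show ?case using L0 by simp
  next
    case (Suc k)
    have "of_nat (Suc k) \<cdot>\<^sub>v v = v + of_nat k \<cdot>\<^sub>v v" using v by (simp add: add_smult_distrib_vec)
    then show ?case using Suc v add by (simp add: algebra_simps)
  qed
  then show ?thesis using surj_of_nat_mod_ring[of c] by auto
qed

lemma additive_mod_ring_scalar_prod:
  fixes L :: "'p::prime_card mod_ring vec \<Rightarrow> 'p mod_ring"
  assumes add: "\<And>u v. u \<in> carrier_vec n \<Longrightarrow> v \<in> carrier_vec n \<Longrightarrow> L (u + v) = L u + L v"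
    and v: "v \<in> carrier_vec n"
  shows "L v = vec n (\<lambda>i. L (unit_vec n i)) \<bullet> v"
proof -
  have L0: "L (0\<^sub>v n) = 0" using add[of "0\<^sub>v n" "0\<^sub>v n"]
    by (metis add_cancel_right_right left_zero_vec zero_carrier_vec)
  \<comment> \<open>Induction on the number k of leading coordinates of v that are kept; each step
    adds one multiple of a unit vector.\<close>
  have "L (vec n (\<lambda>i. if i < k then v $ i else 0)) = (\<Sum>i<k. L (unit_vec n i) * v $ i)" if "k \<le> n" for k
    using that
  proof (induction k)
    case 0
    have "vec n (\<lambda>i. 0) = (0\<^sub>v n :: 'p mod_ring vec)" by auto
    then show ?case using L0 by simp
  next
    case (Suc k)
    let ?u = "vec n (\<lambda>i. if i < k then v $ i else 0)"
    have "vec n (\<lambda>i. if i < Suc k then v $ i else 0) = ?u + v $ k \<cdot>\<^sub>v unit_vec n k"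
      using Suc.prems by (intro eq_vecI) (auto simp: less_Suc_eq)
    moreover have "L (?u + v $ k \<cdot>\<^sub>v unit_vec n k) = L ?u + v $ k * L (unit_vec n k)"
      by (subst add) (auto simp: additive_mod_ring_scale[OF add])
    ultimately show ?case using Suc by simp
  qed
  from this[of n] have "L (vec n (\<lambda>i. if i < n then v $ i else 0)) = (\<Sum>i<n. L (unit_vec n i) * v $ i)" by simp
  moreover have "vec n (\<lambda>i. if i < n then v $ i else 0) = v" using v by auto
  ultimately show ?thesis using v by (simp add: scalar_prod_def atLeast0LessThan)
qed

lemma additive_mod_ring_mat:
  fixes f :: "'p::prime_card mod_ring vec \<Rightarrow> 'p mod_ring vec"
  assumes add: "\<And>u v. u \<in> carrier_vec n \<Longrightarrow> v \<in> carrier_vec n \<Longrightarrow> f (u + v) = f u + f v"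
    and closed: "\<And>v. v \<in> carrier_vec n \<Longrightarrow> f v \<in> carrier_vec m"
  obtains A where "A \<in> carrier_mat m n" "\<And>v. v \<in> carrier_vec n \<Longrightarrow> f v = A *\<^sub>v v"
proof
  let ?A = "mat m n (\<lambda>(i, j). f (unit_vec n j) $ i)"
  show "?A \<in> carrier_mat m n" by simp
  fix v :: "'p mod_ring vec" assume v: "v \<in> carrier_vec n"
  show "f v = ?A *\<^sub>v v"
  proof (rule eq_vecI)
    fix i assume "i < dim_vec (?A *\<^sub>v v)"
    then have i: "i < m" by simp
    have "f v $ i = vec n (\<lambda>j. f (unit_vec n j) $ i) \<bullet> v"
    proof (rule additive_mod_ring_scalar_prod[OF _ v])
      fix u w :: "'p mod_ring vec" assume "u \<in> carrier_vec n" "w \<in> carrier_vec n"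
      then show "f (u + w) $ i = f u $ i + f w $ i" using i add closed[of u] closed[of w] by simp
    qed
    also have "vec n (\<lambda>j. f (unit_vec n j) $ i) = row ?A i" using i by auto
    finally show "f v $ i = (?A *\<^sub>v v) $ i" using i by simp
  qed (use closed[OF v] in auto)
qed

section \<open>Coordinates on the group and its dual\<close>

text \<open>Collects the two choices behind the translation: coordinates \<theta> identifying G with
  Z_p^s, and an element \<zeta> of order p that serves as base for logarithms of characters.\<close>

locale vector_group = G: group G + F: field F
  for G :: "('a, 'm) monoid_scheme" and F :: "('f, 'r) ring_scheme" +
  fixes \<theta> :: "'a \<Rightarrow> 'p::prime_card mod_ring vec" and s :: nat and \<zeta> :: 'f
  assumes bij: "bij_betw \<theta> (carrier G) (carrier_vec s)"
    and add: "\<And>x y. x \<in> carrier G \<Longrightarrow> y \<in> carrier G \<Longrightarrow> \<theta> (x \<otimes>\<^bsub>G\<^esub> y) = \<theta> x + \<theta> y"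
    and zeta: "\<zeta> \<in> carrier (mult_of F)" "group.ord (mult_of F) \<zeta> = CARD('p)"
begin

sublocale U: group "mult_of F" by (rule F.field_mult_group)

declare mult_of_simps [simp del]

text \<open>The exponential with base \<zeta>. The representative in {0..p-1} makes the exponent a
  natural number.\<close>

definition zpow :: "'p mod_ring \<Rightarrow> 'f" where
  "zpow a = \<zeta> [^]\<^bsub>mult_of F\<^esub> nat (to_int_mod_ring a)"

lemma zpow_closed [simp]: "zpow a \<in> carrier (mult_of F)"
  using zeta by (simp add: zpow_def)

text \<open>As \<zeta>^p = 1, any natural representative may serve as exponent. This reduces the
  laws of \<open>zpow\<close> to those of natural powers.\<close>

lemma zpow_of_nat: "zpow (of_nat k) = \<zeta> [^]\<^bsub>mult_of F\<^esub> k"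
proof -
  have "to_int_mod_ring (of_nat k :: 'p mod_ring) = int (k mod CARD('p))"
    unfolding of_nat_of_int_mod_ring o_def by transfer (simp add: zmod_int)
  then have *: "zpow (of_nat k) = \<zeta> [^]\<^bsub>mult_of F\<^esub> (k mod CARD('p))" by (simp add: zpow_def)
  have "\<zeta> [^]\<^bsub>mult_of F\<^esub> k = \<zeta> [^]\<^bsub>mult_of F\<^esub> (CARD('p) * (k div CARD('p)) + k mod CARD('p))" by simp
  also have "\<dots> = (\<zeta> [^]\<^bsub>mult_of F\<^esub> CARD('p)) [^]\<^bsub>mult_of F\<^esub> (k div CARD('p)) \<otimes>\<^bsub>mult_of F\<^esub> \<zeta> [^]\<^bsub>mult_of F\<^esub> (k mod CARD('p))"
    using zeta(1) by (simp only: U.nat_pow_mult U.nat_pow_pow U.nat_pow_closed)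
  also have "\<dots> = \<zeta> [^]\<^bsub>mult_of F\<^esub> (k mod CARD('p))"
    using U.pow_ord_eq_1[OF zeta(1)] zeta by simp
  finally show ?thesis using * by simp
qed

lemma zpow_add: "zpow (a + b) = zpow a \<otimes>\<^bsub>mult_of F\<^esub> zpow b"
proof -
  obtain i j where "a = of_nat i" "b = of_nat j" using surj_of_nat_mod_ring by metis
  then show ?thesis using zeta(1) by (simp add: zpow_of_nat U.nat_pow_mult flip: of_nat_add)
qed

lemma inj_zpow: "inj zpow"
proof (rule injI)
  fix a b assume eq: "zpow a = zpow b"
  obtain i where i: "i < CARD('p)" "a = of_nat i" using surj_of_nat_mod_ring by metis
  obtain j where j: "j < CARD('p)" "b = of_nat j" using surj_of_nat_mod_ring by metis
  have "inj_on (\<lambda>k. \<zeta> [^]\<^bsub>mult_of F\<^esub> k) {0..CARD('p) - 1}"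
    using U.ord_inj[OF zeta(1)] zeta(2) by simp
  then show "a = b" using eq i j by (auto simp: zpow_of_nat dest: inj_onD)
qed

lemma zpow_pow_card: "zpow a [^]\<^bsub>mult_of F\<^esub> CARD('p) = \<one>\<^bsub>mult_of F\<^esub>"
proof -
  obtain k where "a = of_nat k" using surj_of_nat_mod_ring by metis
  then have "zpow a [^]\<^bsub>mult_of F\<^esub> CARD('p) = \<zeta> [^]\<^bsub>mult_of F\<^esub> (k * CARD('p))"
    using zeta(1) by (simp only: zpow_of_nat U.nat_pow_pow)
  also have "\<dots> = \<one>\<^bsub>mult_of F\<^esub>" by (simp only: U.pow_eq_id[OF zeta(1)] zeta(2) dvd_triv_right)
  finally show ?thesis .
qed

lemma range_zpow: "range zpow = {x \<in> carrier (mult_of F). x [^]\<^bsub>mult_of F\<^esub> CARD('p) = \<one>\<^bsub>mult_of F\<^esub>}"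
proof (intro equalityI subsetI)
  fix x assume x: "x \<in> {x \<in> carrier (mult_of F). x [^]\<^bsub>mult_of F\<^esub> CARD('p) = \<one>\<^bsub>mult_of F\<^esub>}"
  \<comment> \<open>The range already contains p roots of X^p - 1, so a further root x would exceed
    the bound for a field.\<close>
  have "insert x (range zpow) \<subseteq> {x \<in> carrier (mult_of F). x [^]\<^bsub>mult_of F\<^esub> CARD('p) = \<one>\<^bsub>mult_of F\<^esub>}"
    using x zpow_pow_card by auto
  then have "insert x (range zpow) \<subseteq> {x \<in> carrier F. x [^]\<^bsub>F\<^esub> CARD('p) = \<one>\<^bsub>F\<^esub>}"
    unfolding mult_of_simps by blast
  then have "card (insert x (range zpow)) \<le> CARD('p)"
    by (rule F.card_roots_of_unity_le[rotated]) auto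
  then show "x \<in> range zpow"
    by (cases "x \<in> range zpow") (auto simp: card_image[OF inj_zpow])
qed (use zpow_pow_card in auto)

lemma theta_closed: "x \<in> carrier G \<Longrightarrow> \<theta> x \<in> carrier_vec s"
  using bij by (auto simp: bij_betw_def)

lemma theta_inj: "x \<in> carrier G \<Longrightarrow> y \<in> carrier G \<Longrightarrow> \<theta> x = \<theta> y \<Longrightarrow> x = y"
  using bij by (auto simp: bij_betw_def dest: inj_onD)

abbreviation (input) theta_inv where "theta_inv \<equiv> inv_into (carrier G) \<theta>"

lemma theta_inv: "v \<in> carrier_vec s \<Longrightarrow> theta_inv v \<in> carrier G" "v \<in> carrier_vec s \<Longrightarrow> \<theta> (theta_inv v) = v"
  using bij by (metis bij_betw_def inv_into_into, metis bij_betw_inv_into_right)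

lemma theta_inv_left: "x \<in> carrier G \<Longrightarrow> theta_inv (\<theta> x) = x"
  using bij by (rule bij_betw_inv_into_left)

lemma theta_one: "\<theta> \<one>\<^bsub>G\<^esub> = 0\<^sub>v s"
proof -
  have "\<theta> \<one>\<^bsub>G\<^esub> = \<theta> \<one>\<^bsub>G\<^esub> + \<theta> \<one>\<^bsub>G\<^esub>" using add[of "\<one>\<^bsub>G\<^esub>" "\<one>\<^bsub>G\<^esub>"] by simp
  then have "\<theta> \<one>\<^bsub>G\<^esub> $ i = 0" if "i < s" for i
    using that theta_closed[of "\<one>\<^bsub>G\<^esub>"]
    by (metis G.one_closed add_cancel_right_right carrier_vecD index_add_vec(1))
  then show ?thesis using theta_closed[of "\<one>\<^bsub>G\<^esub>"] by (intro eq_vecI) auto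
qed

lemma theta_pow: "x \<in> carrier G \<Longrightarrow> \<theta> (x [^]\<^bsub>G\<^esub> k) = of_nat k \<cdot>\<^sub>v \<theta> x"
proof (induction k)
  case 0
  then show ?case using theta_closed[of x] by (auto simp: theta_one)
next
  case (Suc k)
  then show ?case using theta_closed[of x]
    by (simp add: add add_smult_distrib_vec comm_add_vec[of _ s])
qed

text \<open>The usual pairing of Z_p^s with itself, read multiplicatively. It is restricted to the
  carrier because members of \<open>characters\<close> are extensional.\<close>

definition chi :: "'p mod_ring vec \<Rightarrow> 'a \<Rightarrow> 'f" where
  "chi w = (\<lambda>x\<in>carrier G. zpow (w \<bullet> \<theta> x))"

text \<open>Nondegeneracy of the scalar product, tested on the group elements whose coordinates are
  unit vectors.\<close>

lemma chi_eqD: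
  assumes "w \<in> carrier_vec s" "w' \<in> carrier_vec s"
    and "\<And>x. x \<in> carrier G \<Longrightarrow> w \<bullet> \<theta> x = w' \<bullet> \<theta> x"
  shows "w = w'"
proof (rule eq_vecI)
  fix i assume "i < dim_vec w'"
  then have i: "i < s" using assms by simp
  show "w $ i = w' $ i"
    using assms(3)[of "theta_inv (unit_vec s i)"] theta_inv[of "unit_vec s i"] i assms(1,2) by simp
qed (use assms in simp)

lemma bij_chi: "bij_betw chi (carrier_vec s) (characters G F)"
  unfolding bij_betw_def
proof (intro conjI equalityI subsetI)
  show "inj_on chi (carrier_vec s)"
  proof (rule inj_onI)
    fix w w' assume w: "w \<in> carrier_vec s" "w' \<in> carrier_vec s" and eq: "chi w = chi w'"
    show "w = w'"
    proof (rule chi_eqD[OF w])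
      fix x assume "x \<in> carrier G"
      then show "w \<bullet> \<theta> x = w' \<bullet> \<theta> x"
        using fun_cong[OF eq, of x] inj_zpow by (auto simp: chi_def dest: injD)
    qed
  qed
  fix \<chi> assume "\<chi> \<in> chi ` carrier_vec s"
  then obtain w where w: "w \<in> carrier_vec s" "\<chi> = chi w" by auto
  show "\<chi> \<in> characters G F"
    unfolding w(2) characters_def
    by (auto simp: hom_def chi_def add zpow_add scalar_prod_add_distrib[OF w(1)] theta_closed)
next
  fix \<chi> assume \<chi>: "\<chi> \<in> characters G F"
  then have hom: "\<chi> \<in> hom G (mult_of F)" and ext: "\<chi> \<in> extensional (carrier G)"
    by (auto simp: characters_def)
  interpret h: group_hom G "mult_of F" \<chi>
    using hom by unfold_locales
  \<comment> \<open>In coordinates x^p is p times a vector over Z_p, hence 0; so x^p = 1 and \<chi>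
    x is a p-th root of unity.\<close>
  have root: "\<chi> x \<in> range zpow" if x: "x \<in> carrier G" for x
  proof -
    have "\<theta> (x [^]\<^bsub>G\<^esub> CARD('p)) = \<theta> \<one>\<^bsub>G\<^esub>"
      using x theta_closed[OF x] by (auto simp: theta_pow theta_one)
    then have "x [^]\<^bsub>G\<^esub> CARD('p) = \<one>\<^bsub>G\<^esub>" using x theta_inj by simp
    then have "\<chi> x [^]\<^bsub>mult_of F\<^esub> CARD('p) = \<one>\<^bsub>mult_of F\<^esub>"
      using h.hom_nat_pow[OF x, of "CARD('p)"] by simp
    then show ?thesis using x by (simp add: range_zpow)
  qed
  \<comment> \<open>The logarithm of \<chi> to base \<zeta>, moved to coordinate vectors. It is
    additive, so its values on unit vectors give the vector representing \<chi>.\<close>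
  define L where "L v = inv_into UNIV zpow (\<chi> (theta_inv v))" for v
  have zL: "zpow (L (\<theta> x)) = \<chi> x" if "x \<in> carrier G" for x
    using root[OF that] that by (simp add: L_def theta_inv_left f_inv_into_f)
  have Ladd: "L (u + v) = L u + L v" if uv: "u \<in> carrier_vec s" "v \<in> carrier_vec s" for u v
  proof -
    obtain x y where xy: "x \<in> carrier G" "y \<in> carrier G" "u = \<theta> x" "v = \<theta> y"
      using uv theta_inv by metis
    have "zpow (L (u + v)) = zpow (L u + L v)"
      using zL[of "x \<otimes>\<^bsub>G\<^esub> y"] xy by (simp add: add zpow_add zL)
    then show ?thesis using inj_zpow by (auto dest: injD)
  qed
  have "\<chi> = chi (vec s (\<lambda>i. L (unit_vec s i)))"
  proof (rule extensionalityI[OF ext])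
    fix x assume x: "x \<in> carrier G"
    then show "\<chi> x = chi (vec s (\<lambda>i. L (unit_vec s i))) x"
      using additive_mod_ring_scalar_prod[of s L "\<theta> x"] Ladd theta_closed[OF x] zL[OF x]
      by (simp add: chi_def)
  qed (simp add: chi_def)
  then show "\<chi> \<in> chi ` carrier_vec s" by auto
qed

text \<open>A matrix moves across the scalar product as its transpose. Then \<open>inj_zpow\<close>
  removes the exponential and \<open>chi_eqD\<close> the test elements.\<close>

lemma chi_comp_iff:
  assumes w: "w \<in> carrier_vec s" "w' \<in> carrier_vec s" and A: "A \<in> carrier_mat s s"
    and f: "\<And>x. x \<in> carrier G \<Longrightarrow> f x \<in> carrier G" "\<And>x. x \<in> carrier G \<Longrightarrow> \<theta> (f x) = A *\<^sub>v \<theta> x"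
  shows "(\<forall>x\<in>carrier G. chi w' (f x) = chi w x) \<longleftrightarrow> A\<^sup>T *\<^sub>v w' = w"
proof -
  have "chi w' (f x) = chi w x \<longleftrightarrow> (A\<^sup>T *\<^sub>v w') \<bullet> \<theta> x = w \<bullet> \<theta> x" if x: "x \<in> carrier G" for x
    using x f inj_zpow transpose_vec_mult_scalar[OF A theta_closed[OF x] w(2)]
    by (auto simp: chi_def dest: injD)
  moreover have "A\<^sup>T *\<^sub>v w' \<in> carrier_vec s" using A w by simp
  ultimately show ?thesis using chi_eqD[OF _ w(1)] by auto
qed

text \<open>In coordinates \<phi> is additive, hence given by a matrix; injectivity of \<phi> makes
  the kernel trivial and the determinant nonzero.\<close>

lemma iso_imp_GL:
  assumes \<phi>: "\<phi> \<in> iso G G"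
  obtains A where "A \<in> GL s" "\<And>x. x \<in> carrier G \<Longrightarrow> \<theta> (\<phi> x) = A *\<^sub>v \<theta> x"
proof -
  have \<phi>c: "\<phi> x \<in> carrier G" if "x \<in> carrier G" for x using \<phi> that by (auto simp: iso_def hom_def)
  have \<phi>b: "bij_betw \<phi> (carrier G) (carrier G)" using \<phi> by (simp add: iso_def)
  have \<phi>m: "\<phi> (x \<otimes>\<^bsub>G\<^esub> y) = \<phi> x \<otimes>\<^bsub>G\<^esub> \<phi> y" if "x \<in> carrier G" "y \<in> carrier G" for x y
    using \<phi> that by (auto simp: iso_def hom_def)
  define f where "f v = \<theta> (\<phi> (theta_inv v))" for v
  have f\<theta>: "f (\<theta> x) = \<theta> (\<phi> x)" if "x \<in> carrier G" for x using that by (simp add: f_def theta_inv_left)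
  have f_add: "f (u + v) = f u + f v" if uv: "u \<in> carrier_vec s" "v \<in> carrier_vec s" for u v
  proof -
    obtain x y where xy: "x \<in> carrier G" "y \<in> carrier G" "u = \<theta> x" "v = \<theta> y"
      using uv theta_inv by metis
    then show ?thesis using f\<theta>[of "x \<otimes>\<^bsub>G\<^esub> y"] by (simp add: f\<theta> add \<phi>m \<phi>c)
  qed
  have f_closed: "f v \<in> carrier_vec s" if "v \<in> carrier_vec s" for v
    using that by (simp add: f_def theta_closed \<phi>c theta_inv)
  obtain A where A: "A \<in> carrier_mat s s" "\<And>v. v \<in> carrier_vec s \<Longrightarrow> f v = A *\<^sub>v v"
    using additive_mod_ring_mat[of s f s] f_add f_closed by metis
  have A\<theta>: "\<theta> (\<phi> x) = A *\<^sub>v \<theta> x" if "x \<in> carrier G" for x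
    using A(2)[OF theta_closed[OF that]] f\<theta>[OF that] by simp
  have "v = 0\<^sub>v s" if v: "v \<in> carrier_vec s" "A *\<^sub>v v = 0\<^sub>v s" for v
  proof -
    obtain x where x: "x \<in> carrier G" "v = \<theta> x" using v theta_inv by metis
    have "A *\<^sub>v \<theta> \<one>\<^bsub>G\<^esub> = 0\<^sub>v s" using A(1) by (intro eq_vecI) (auto simp: theta_one)
    then have "\<theta> (\<phi> x) = \<theta> (\<phi> \<one>\<^bsub>G\<^esub>)" using A\<theta> x v by simp
    then have "\<phi> x = \<phi> \<one>\<^bsub>G\<^esub>" using theta_inj \<phi>c x by simp
    then have "x = \<one>\<^bsub>G\<^esub>" using \<phi>b x by (auto simp: bij_betw_def dest: inj_onD)
    then show ?thesis using x theta_one by simp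
  qed
  then have "det A \<noteq> 0" using det_0_iff_vec_prod_zero_field[OF A(1)] by blast
  then show thesis using that A A\<theta> by (auto simp: GL_eq_det)
qed

lemma GL_imp_iso:
  assumes A: "A \<in> GL s" and B: "B \<in> carrier_mat s s" "A * B = 1\<^sub>m s" "B * A = 1\<^sub>m s"
  obtains \<phi> where "\<phi> \<in> iso G G" "\<And>x. x \<in> carrier G \<Longrightarrow> \<theta> (\<phi> x) = A *\<^sub>v \<theta> x"
proof
  let ?\<phi> = "\<lambda>M x. theta_inv (M *\<^sub>v \<theta> x)"
  have cA: "A \<in> carrier_mat s s" using A by (simp add: GL_def)
  have \<theta>\<phi>: "?\<phi> M x \<in> carrier G" "\<theta> (?\<phi> M x) = M *\<^sub>v \<theta> x" if "M \<in> carrier_mat s s" "x \<in> carrier G" for M x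
    using that theta_closed[of x] by (simp_all add: theta_inv)
  show "\<theta> (?\<phi> A x) = A *\<^sub>v \<theta> x" if "x \<in> carrier G" for x using \<theta>\<phi>(2)[OF cA that] .
  have cancel: "?\<phi> M (?\<phi> N x) = x" if M: "M \<in> carrier_mat s s" and N: "N \<in> carrier_mat s s"
    and MN: "M * N = 1\<^sub>m s" and x: "x \<in> carrier G" for M N x
  proof -
    have "M *\<^sub>v (N *\<^sub>v \<theta> x) = \<theta> x"
      using assoc_mult_mat_vec[OF M N theta_closed[OF x]] MN theta_closed[OF x] by simp
    then show ?thesis using \<theta>\<phi>(2)[OF N x] x by (simp add: theta_inv_left)
  qed
  have "bij_betw (?\<phi> A) (carrier G) (carrier G)"
    by (rule bij_betw_byWitness[where f' = "?\<phi> B"]) (use cancel B cA \<theta>\<phi>(1) in auto)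
  moreover have "?\<phi> A \<in> hom G G"
  proof (rule homI)
    fix x y assume xy: "x \<in> carrier G" "y \<in> carrier G"
    have "\<theta> (?\<phi> A (x \<otimes>\<^bsub>G\<^esub> y)) = \<theta> (?\<phi> A x \<otimes>\<^bsub>G\<^esub> ?\<phi> A y)"
    proof -
      have "\<theta> (?\<phi> A (x \<otimes>\<^bsub>G\<^esub> y)) = A *\<^sub>v (\<theta> x + \<theta> y)"
        using \<theta>\<phi>(2)[OF cA G.m_closed[OF xy]] by (simp only: add[OF xy])
      also have "\<dots> = \<theta> (?\<phi> A x) + \<theta> (?\<phi> A y)"
        using xy theta_closed by (simp only: \<theta>\<phi>(2)[OF cA] mult_add_distrib_mat_vec[OF cA])
      also have "\<dots> = \<theta> (?\<phi> A x \<otimes>\<^bsub>G\<^esub> ?\<phi> A y)"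
        by (rule add[symmetric]) (rule \<theta>\<phi>(1)[OF cA xy(1)], rule \<theta>\<phi>(1)[OF cA xy(2)])
      finally show ?thesis .
    qed
    then show "?\<phi> A (x \<otimes>\<^bsub>G\<^esub> y) = ?\<phi> A x \<otimes>\<^bsub>G\<^esub> ?\<phi> A y"
      using xy cA \<theta>\<phi>(1) by (intro theta_inj) auto
  qed (use \<theta>\<phi>(1) cA in auto)
  ultimately show "?\<phi> A \<in> iso G G" by (simp add: iso_def)
qed

end

subsection \<open>Classes as orbits of the general linear group\<close>

text \<open>Both images are the quotient of A by one and the same equivalence relation. This later
  exchanges isomorphism classes for orbits.\<close>

lemma card_image_eq_if_same_kernel:
  assumes "\<And>x y. x \<in> A \<Longrightarrow> y \<in> A \<Longrightarrow> f x = f y \<longleftrightarrow> g x = g y"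
  shows "card (f ` A) = card (g ` A)"
proof (rule bij_betw_same_card)
  show "bij_betw (\<lambda>c. g (inv_into A f c)) (f ` A) (g ` A)"
  proof (rule bij_betwI')
    fix c d assume cd: "c \<in> f ` A" "d \<in> f ` A"
    then show "g (inv_into A f c) = g (inv_into A f d) \<longleftrightarrow> c = d"
      using assms[of "inv_into A f c" "inv_into A f d"] by (simp add: inv_into_into f_inv_into_f)
  next
    fix c assume "c \<in> f ` A" then show "g (inv_into A f c) \<in> g ` A" by (simp add: inv_into_into)
  next
    fix y assume "y \<in> g ` A"
    then obtain x where x: "x \<in> A" "y = g x" by auto
    then have "f (inv_into A f (f x)) = f x" by (simp add: f_inv_into_f)
    then have "g (inv_into A f (f x)) = g x"
      using assms[of "inv_into A f (f x)" x] x by (simp add: inv_into_into)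
    then show "\<exists>c\<in>f ` A. y = g (inv_into A f c)" using x by (intro bexI[of _ "f x"]) auto
  qed
qed

text \<open>Bijectivity comes from the inverse group element. The action is restricted to E because
  the members of \<open>BijGroup E\<close> are extensional.\<close>

lemma group_actionI:
  assumes H: "group H"
    and closed: "\<And>g x. g \<in> carrier H \<Longrightarrow> x \<in> E \<Longrightarrow> a g x \<in> E"
    and one: "\<And>x. x \<in> E \<Longrightarrow> a \<one>\<^bsub>H\<^esub> x = x"
    and mult: "\<And>g h x. g \<in> carrier H \<Longrightarrow> h \<in> carrier H \<Longrightarrow> x \<in> E \<Longrightarrow> a (g \<otimes>\<^bsub>H\<^esub> h) x = a g (a h x)"
  shows "group_action H E (\<lambda>g. \<lambda>x\<in>E. a g x)"
proof -
  interpret H: group H by fact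
  interpret B: group "BijGroup E" by (rule group_BijGroup)
  have bij: "(\<lambda>x\<in>E. a g x) \<in> Bij E" if g: "g \<in> carrier H" for g
  proof -
    have "bij_betw (a g) E E"
    proof (rule bij_betw_byWitness[where f' = "a (inv\<^bsub>H\<^esub> g)"])
      show "\<forall>x\<in>E. a (inv\<^bsub>H\<^esub> g) (a g x) = x" "\<forall>x\<in>E. a g (a (inv\<^bsub>H\<^esub> g) x) = x"
        using g by (simp_all flip: mult add: one)
    qed (use g closed in auto)
    then show ?thesis by (simp add: Bij_def)
  qed
  have "(\<lambda>g. \<lambda>x\<in>E. a g x) \<in> hom H (BijGroup E)"
  proof (rule homI)
    fix g h assume gh: "g \<in> carrier H" "h \<in> carrier H"
    show "(\<lambda>x\<in>E. a (g \<otimes>\<^bsub>H\<^esub> h) x) = (\<lambda>x\<in>E. a g x) \<otimes>\<^bsub>BijGroup E\<^esub> (\<lambda>x\<in>E. a h x)"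
      using gh bij closed by (auto simp: BijGroup_def compose_def fun_eq_iff mult)
  qed (simp add: BijGroup_def bij)
  then show ?thesis
    by (intro group_action.intro group_hom.intro group_hom_axioms.intro H B.group_axioms)
qed

section \<open>The action on pairs of vectors and its fixed points\<close>

definition GL_group :: "nat \<Rightarrow> 'k::field mat monoid" where
  "GL_group n = units_of (ring_mat TYPE('k) n ())"

lemma group_GL_group: "group (GL_group n :: 'k::field mat monoid)"
proof -
  interpret R: ring "ring_mat TYPE('k) n ()" by (rule ring_mat)
  show ?thesis unfolding GL_group_def by (rule R.units_group)
qed

lemma GL_group_simps [simp]:
  "carrier (GL_group n :: 'k::field mat monoid) = GL n"
  "A \<otimes>\<^bsub>GL_group n\<^esub> B = A * (B :: 'k mat)"
  "\<one>\<^bsub>GL_group n\<^esub> = (1\<^sub>m n :: 'k mat)"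
  by (simp_all add: GL_group_def units_of_carrier units_of_mult units_of_one GL_eq_Units[of n "()"] ring_mat_simps)

lemma GL_carrier: "A \<in> GL n \<Longrightarrow> A \<in> carrier_mat n n"
  by (simp add: GL_def)

lemma GL_inverse:
  fixes A :: "'k::field mat"
  assumes "A \<in> GL n"
  shows "inv\<^bsub>GL_group n\<^esub> A \<in> GL n" "A * inv\<^bsub>GL_group n\<^esub> A = 1\<^sub>m n" "inv\<^bsub>GL_group n\<^esub> A * A = 1\<^sub>m n"
proof -
  interpret H: group "GL_group n :: 'k mat monoid" by (rule group_GL_group)
  show "inv\<^bsub>GL_group n\<^esub> A \<in> GL n" "A * inv\<^bsub>GL_group n\<^esub> A = 1\<^sub>m n" "inv\<^bsub>GL_group n\<^esub> A * A = 1\<^sub>m n"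
    using H.inv_closed[of A] H.r_inv[of A] H.l_inv[of A] assms by simp_all
qed

text \<open>The condition that \<chi>' composed with \<phi> is \<chi> reads A^T w' = w in
  coordinates; solving for w' gives the inverse transpose.\<close>

definition dual_act :: "nat \<Rightarrow> 'k::field mat \<Rightarrow> 'k vec \<times> 'k vec \<Rightarrow> 'k vec \<times> 'k vec" where
  "dual_act n A x = (A *\<^sub>v fst x, (inv\<^bsub>GL_group n\<^esub> A)\<^sup>T *\<^sub>v snd x)"

abbreviation "vec_pairs n \<equiv> carrier_vec n \<times> carrier_vec n"

lemma dual_act_closed:
  "A \<in> GL n \<Longrightarrow> x \<in> vec_pairs n \<Longrightarrow> dual_act n A x \<in> vec_pairs n"
  using GL_inverse(1)[of A n] by (auto simp: dual_act_def dest!: GL_carrier)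

lemma dual_act_one:
  fixes x :: "'k::field vec \<times> 'k vec"
  assumes "x \<in> vec_pairs n"
  shows "dual_act n (1\<^sub>m n) x = x"
proof -
  interpret H: group "GL_group n :: 'k mat monoid" by (rule group_GL_group)
  have "inv\<^bsub>GL_group n\<^esub> (1\<^sub>m n) = (1\<^sub>m n :: 'k mat)" using H.inv_one by simp
  then show ?thesis using assms by (cases x) (auto simp: dual_act_def)
qed

text \<open>Inversion and transposition both reverse products, so together they preserve the order
  and yield a left action.\<close>

lemma dual_act_mult:
  fixes A B :: "'k::field mat"
  assumes AB: "A \<in> GL n" "B \<in> GL n" and x: "x \<in> vec_pairs n"
  shows "dual_act n (A * B) x = dual_act n A (dual_act n B x)"
proof -
  interpret H: group "GL_group n :: 'k mat monoid" by (rule group_GL_group)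
  note c = GL_carrier[OF AB(1)] GL_carrier[OF AB(2)]
    GL_carrier[OF GL_inverse(1)[OF AB(1)]] GL_carrier[OF GL_inverse(1)[OF AB(2)]]
  have "inv\<^bsub>GL_group n\<^esub> (A * B) = inv\<^bsub>GL_group n\<^esub> B * inv\<^bsub>GL_group n\<^esub> A"
    using H.inv_mult_group[of A B] AB by simp
  then have "(inv\<^bsub>GL_group n\<^esub> (A * B))\<^sup>T = (inv\<^bsub>GL_group n\<^esub> A)\<^sup>T * (inv\<^bsub>GL_group n\<^esub> B)\<^sup>T"
    using transpose_mult[OF c(4,3)] by simp
  then show ?thesis using c x by (auto simp: dual_act_def)
qed

text \<open>Removes the inverse, giving the form in which \<open>chi_comp_iff\<close> states
  compatibility of characters.\<close>

lemma dual_act_eq_iff: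
  fixes A :: "'k::field mat"
  assumes A: "A \<in> GL n" and w: "w \<in> carrier_vec n" "w' \<in> carrier_vec n"
  shows "(inv\<^bsub>GL_group n\<^esub> A)\<^sup>T *\<^sub>v w = w' \<longleftrightarrow> A\<^sup>T *\<^sub>v w' = w"
proof -
  let ?B = "inv\<^bsub>GL_group n\<^esub> A"
  note c = GL_carrier[OF A] GL_carrier[OF GL_inverse(1)[OF A]]
  have "A\<^sup>T * ?B\<^sup>T = 1\<^sub>m n" "?B\<^sup>T * A\<^sup>T = 1\<^sub>m n"
    using transpose_mult[OF c(2,1)] transpose_mult[OF c] GL_inverse(2,3)[OF A] by (metis transpose_one)+
  then have "A\<^sup>T *\<^sub>v (?B\<^sup>T *\<^sub>v w) = w" "?B\<^sup>T *\<^sub>v (A\<^sup>T *\<^sub>v w') = w'"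
    using c w assoc_mult_mat_vec[of "A\<^sup>T" n n "?B\<^sup>T" n w] assoc_mult_mat_vec[of "?B\<^sup>T" n n "A\<^sup>T" n w'] by simp_all
  then show ?thesis by auto
qed

lemma funpow_mult_mat_vec:
  assumes A: "A \<in> carrier_mat n n" and v: "v \<in> carrier_vec n"
  shows "((\<lambda>v. A *\<^sub>v v) ^^ k) v = (A ^\<^sub>m k) *\<^sub>v v"
  using v
proof (induction k arbitrary: v)
  case (Suc k)
  then show ?case using A
    by (simp add: funpow_Suc_right assoc_mult_mat_vec[OF pow_carrier_mat[OF A] A] del: funpow.simps)
qed (use A in auto)

lemma transpose_pow_mat:
  fixes A :: "'k::comm_semiring_1 mat"
  assumes A: "A \<in> carrier_mat n n"
  shows "(A ^\<^sub>m k)\<^sup>T = A\<^sup>T ^\<^sub>m k"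
proof (induction k)
  case (Suc k)
  \<comment> \<open>A matrix power multiplies on the right, and transposing would move that factor
    to the left; commuting it first restores the side.\<close>
  have comm: "A * A ^\<^sub>m k = A ^\<^sub>m k * A" for k
  proof (induction k)
    case (Suc k)
    have "A * A ^\<^sub>m Suc k = A * A ^\<^sub>m k * A"
      using assoc_mult_mat[OF A pow_carrier_mat[OF A] A, of k] by simp
    then show ?case using Suc by simp
  qed (use A in simp)
  have "(A ^\<^sub>m Suc k)\<^sup>T = (A * A ^\<^sub>m k)\<^sup>T" by (simp add: comm)
  also have "\<dots> = (A ^\<^sub>m k)\<^sup>T * A\<^sup>T" by (rule transpose_mult[OF A pow_carrier_mat[OF A]])
  finally show ?case using Suc by simp
qed (use A in simp)

text \<open>The condition splits: v lies in the kernel of A^k - I and w in the kernel of its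
  transpose. The two kernels have equal size, hence the factor 2 in the exponent.\<close>

lemma card_fixed_dual_act:
  fixes A :: "'k::{field,finite} mat"
  assumes A: "A \<in> GL n"
  shows "card {x \<in> vec_pairs n. (dual_act n A ^^ k) x = x} = CARD('k) ^ (2 * (n - vec_space.rank n (A ^\<^sub>m k - 1\<^sub>m n)))"
proof -
  let ?B = "inv\<^bsub>GL_group n\<^esub> A" and ?M = "A ^\<^sub>m k - 1\<^sub>m n"
  note cA = GL_carrier[OF A] and cB = GL_carrier[OF GL_inverse(1)[OF A]]
  have M: "?M \<in> carrier_mat n n" using cA by (simp add: minus_carrier_mat)
  have pair: "(dual_act n A ^^ k) (v, w) = ((A ^\<^sub>m k) *\<^sub>v v, ((\<lambda>w. ?B\<^sup>T *\<^sub>v w) ^^ k) w)"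
    if "v \<in> carrier_vec n" for v w
  proof -
    have "(dual_act n A ^^ k) (v, w) = (((\<lambda>v. A *\<^sub>v v) ^^ k) v, ((\<lambda>w. ?B\<^sup>T *\<^sub>v w) ^^ k) w)"
      by (induction k) (simp_all add: dual_act_def)
    then show ?thesis using funpow_mult_mat_vec[OF cA that] by simp
  qed
  \<comment> \<open>Stated for two vectors because the induction step replaces w by its image while
    w' stays; the fixed-point case is w = w'.\<close>
  have dual: "((\<lambda>w. ?B\<^sup>T *\<^sub>v w) ^^ k) w = w' \<longleftrightarrow> ((\<lambda>w. A\<^sup>T *\<^sub>v w) ^^ k) w' = w"
    if "w \<in> carrier_vec n" "w' \<in> carrier_vec n" for w w' k
    using that
  proof (induction k arbitrary: w)
    case (Suc k)
    have Bw: "?B\<^sup>T *\<^sub>v w \<in> carrier_vec n" using cB Suc.prems by simp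
    have Aw: "((\<lambda>w. A\<^sup>T *\<^sub>v w) ^^ k) w' \<in> carrier_vec n"
      using Suc.prems cA by (induction k) auto
    have "((\<lambda>w. ?B\<^sup>T *\<^sub>v w) ^^ Suc k) w = w' \<longleftrightarrow> ((\<lambda>w. A\<^sup>T *\<^sub>v w) ^^ k) w' = ?B\<^sup>T *\<^sub>v w"
      using Suc.IH[OF Bw Suc.prems(2)] by (simp add: funpow_Suc_right del: funpow.simps)
    also have "\<dots> \<longleftrightarrow> ((\<lambda>w. A\<^sup>T *\<^sub>v w) ^^ Suc k) w' = w"
      using dual_act_eq_iff[OF A Suc.prems(1) Aw] by auto
    finally show ?case .
  qed auto
  have minus_eq_0: "u - v = 0\<^sub>v n \<longleftrightarrow> u = v" if "u \<in> carrier_vec n" "v \<in> carrier_vec n" for u v :: "'k vec"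
    using that by (auto simp: vec_eq_iff)
  have eq1: "(A ^\<^sub>m k) *\<^sub>v v = v \<longleftrightarrow> ?M *\<^sub>v v = 0\<^sub>v n" if v: "v \<in> carrier_vec n" for v
  proof -
    have "?M *\<^sub>v v = (A ^\<^sub>m k) *\<^sub>v v - v"
      using minus_mult_distrib_mat_vec[OF pow_carrier_mat[OF cA] one_carrier_mat v] v by simp
    moreover have "(A ^\<^sub>m k) *\<^sub>v v \<in> carrier_vec n" by (rule mult_mat_vec_carrier[OF pow_carrier_mat[OF cA] v])
    ultimately show ?thesis using v by (simp add: minus_eq_0)
  qed
  have eq2: "((\<lambda>w. ?B\<^sup>T *\<^sub>v w) ^^ k) w = w \<longleftrightarrow> ?M\<^sup>T *\<^sub>v w = 0\<^sub>v n" if w: "w \<in> carrier_vec n" for w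
  proof -
    have "((\<lambda>w. ?B\<^sup>T *\<^sub>v w) ^^ k) w = w \<longleftrightarrow> (A\<^sup>T ^\<^sub>m k) *\<^sub>v w = w"
      using dual[OF w w] funpow_mult_mat_vec[of "A\<^sup>T" n w k] cA w by simp
    also have "A\<^sup>T ^\<^sub>m k = (A ^\<^sub>m k)\<^sup>T" by (rule transpose_pow_mat[OF cA, symmetric])
    also have "(A ^\<^sub>m k)\<^sup>T *\<^sub>v w = w \<longleftrightarrow> ?M\<^sup>T *\<^sub>v w = 0\<^sub>v n"
    proof -
      have "?M\<^sup>T = (A ^\<^sub>m k)\<^sup>T - 1\<^sub>m n"
        using transpose_minus[OF pow_carrier_mat[OF cA] one_carrier_mat] by simp
      then have "?M\<^sup>T *\<^sub>v w = (A ^\<^sub>m k)\<^sup>T *\<^sub>v w - w"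
        using minus_mult_distrib_mat_vec[OF transpose_carrier_mat[THEN iffD2, OF pow_carrier_mat[OF cA]] one_carrier_mat w] w by simp
      moreover have "(A ^\<^sub>m k)\<^sup>T *\<^sub>v w \<in> carrier_vec n" by (rule mult_mat_vec_carrier[OF transpose_carrier_mat[THEN iffD2, OF pow_carrier_mat[OF cA]] w])
      ultimately show ?thesis using w by (simp add: minus_eq_0)
    qed
    finally show ?thesis .
  qed
  have "{x \<in> vec_pairs n. (dual_act n A ^^ k) x = x} =
      {v \<in> carrier_vec n. ?M *\<^sub>v v = 0\<^sub>v n} \<times> {w \<in> carrier_vec n. ?M\<^sup>T *\<^sub>v w = 0\<^sub>v n}"
    using pair eq1 eq2 by auto
  then show ?thesis
    using card_mat_kernel[OF M] card_mat_kernel_transpose[OF M]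
    by (simp add: card_cartesian_product mult_2 flip: power_add)
qed

lemma card_fixed_msets_dual_act:
  fixes A :: "'k::{field,finite} mat"
  assumes A: "A \<in> GL s"
  shows "real (card (fixed_msets (dual_act s A) (vec_pairs s) n)) =
    cycle_sum (\<lambda>k. real CARD('k) ^ (2 * (s - vec_space.rank s (A ^\<^sub>m k - 1\<^sub>m s)))) n n"
proof -
  let ?W = "vec_pairs s :: ('k vec \<times> 'k vec) set"
  \<comment> \<open>\<open>permutes\<close> demands the identity outside the set. On
    \<open>?W\<close> nothing changes, so fixed points of powers and invariant multisets are the
    same for f and for \<open>dual_act\<close>.\<close>
  define f where "f x = (if x \<in> ?W then dual_act s A x else x)" for x
  have finW: "finite ?W" by simp
  have closed: "dual_act s A x \<in> ?W" if "x \<in> ?W" for x using dual_act_closed[OF A that] .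
  have B: "inv\<^bsub>GL_group s\<^esub> A \<in> GL s" using GL_inverse(1)[OF A] .
  have "bij_betw f ?W ?W"
  proof (rule bij_betw_byWitness[where f' = "dual_act s (inv\<^bsub>GL_group s\<^esub> A)"])
    show "\<forall>x\<in>?W. dual_act s (inv\<^bsub>GL_group s\<^esub> A) (f x) = x"
      using dual_act_mult[OF B A] dual_act_one GL_inverse[OF A] by (metis f_def)
    show "\<forall>x\<in>?W. f (dual_act s (inv\<^bsub>GL_group s\<^esub> A) x) = x"
      using dual_act_mult[OF A B] dual_act_one GL_inverse[OF A] dual_act_closed[OF B] by (metis f_def)
    show "f ` ?W \<subseteq> ?W" using closed by (simp add: f_def image_subset_iff)
    show "dual_act s (inv\<^bsub>GL_group s\<^esub> A) ` ?W \<subseteq> ?W" using dual_act_closed[OF B] by blast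
  qed
  then have perm: "f permutes ?W" by (rule bij_imp_permutes) (simp add: f_def)
  have "(f ^^ k) x = (dual_act s A ^^ k) x \<and> (dual_act s A ^^ k) x \<in> ?W" if x: "x \<in> ?W" for x k
    by (induction k) (use x closed in \<open>auto simp: f_def\<close>)
  then have "{x \<in> ?W. (f ^^ k) x = x} = {x \<in> ?W. (dual_act s A ^^ k) x = x}" for k by auto
  moreover have "fixed_msets (dual_act s A) ?W n = fixed_msets f ?W n"
  proof -
    have "image_mset (dual_act s A) M = image_mset f M" if "M \<in> msets_of_size ?W n" for M
      using that by (intro image_mset_cong) (auto simp: msets_of_size_def f_def)
    then show ?thesis by (auto simp: fixed_msets_def)
  qed
  ultimately show ?thesis
    using card_fixed_msets[OF perm finW order.refl, of n] by (simp add: card_fixed_dual_act[OF A])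
qed

section \<open>Element systems as multisets of vector pairs\<close>

context vector_group
begin

definition chi_inv :: "('a \<Rightarrow> 'f) \<Rightarrow> 'p mod_ring vec" where
  "chi_inv = inv_into (carrier_vec s) chi"

lemma chi_inv: "\<chi> \<in> characters G F \<Longrightarrow> chi_inv \<chi> \<in> carrier_vec s" "\<chi> \<in> characters G F \<Longrightarrow> chi (chi_inv \<chi>) = \<chi>"
  unfolding chi_inv_def using bij_chi
  by (metis bij_betw_def inv_into_into, metis bij_betw_inv_into_right)

lemma chi_inv_chi: "w \<in> carrier_vec s \<Longrightarrow> chi_inv (chi w) = w"
  unfolding chi_inv_def using bij_chi by (rule bij_betw_inv_into_left)

definition point :: "('j \<Rightarrow> 'a) \<times> ('j \<Rightarrow> 'a \<Rightarrow> 'f) \<Rightarrow> 'j \<Rightarrow> 'p mod_ring vec \<times> 'p mod_ring vec" where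
  "point X i = (\<theta> (fst X i), chi_inv (snd X i))"

lemma point_closed: "X \<in> ESC G F J \<Longrightarrow> i \<in> J \<Longrightarrow> point X i \<in> vec_pairs s"
  by (auto simp: point_def ESC_def theta_closed chi_inv PiE_iff)

text \<open>Forgetting the indices absorbs the bijection \<sigma> of an isomorphism, so that only
  the matrix action remains.\<close>

definition esc_mset :: "'j set \<Rightarrow> ('j \<Rightarrow> 'a) \<times> ('j \<Rightarrow> 'a \<Rightarrow> 'f) \<Rightarrow> ('p mod_ring vec \<times> 'p mod_ring vec) multiset" where
  "esc_mset J X = image_mset (point X) (mset_set J)"

lemma esc_mset_closed: "finite J \<Longrightarrow> X \<in> ESC G F J \<Longrightarrow> esc_mset J X \<in> msets_of_size (vec_pairs s) (card J)"
  by (simp add: esc_mset_def msets_of_size_def image_subset_iff point_closed)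

lemma esc_mset_surj:
  assumes M: "M \<in> msets_of_size (vec_pairs s) n"
  obtains X where "X \<in> ESC G F {1..n}" "esc_mset {1..n} X = M"
proof -
  obtain xs where xs: "mset xs = M" using ex_mset by blast
  then have len: "length xs = n" and sub: "set xs \<subseteq> vec_pairs s" using M by (auto simp: msets_of_size_def)
  \<comment> \<open>Lists are indexed from 0 and element systems from 1, whence i - 1. The
    restricted functions make X extensional as \<open>ESC\<close> requires.\<close>
  define X where "X = (\<lambda>i\<in>{1..n}. theta_inv (fst (xs ! (i - 1))), \<lambda>i\<in>{1..n}. chi (snd (xs ! (i - 1))))"
  have el: "xs ! (i - 1) \<in> vec_pairs s" if "i \<in> {1..n}" for i
  proof -
    have "i - 1 < length xs" using that len by auto
    then show ?thesis using sub nth_mem by blast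
  qed
  have chi_char: "chi w \<in> characters G F" if "w \<in> carrier_vec s" for w
    using bij_chi that by (auto simp: bij_betw_def)
  have "X \<in> ESC G F {1..n}"
    using el by (auto simp: X_def ESC_def PiE_iff extensional_def mem_Times_iff
        intro!: theta_inv chi_char)
  moreover have "esc_mset {1..n} X = M"
  proof -
    have "point X i = xs ! (i - 1)" if "i \<in> {1..n}" for i
      using el[OF that] that by (auto simp: point_def X_def theta_inv chi_inv_chi mem_Times_iff prod_eq_iff)
    then have "esc_mset {1..n} X = image_mset (\<lambda>i. xs ! (i - 1)) (mset_set {1..n})"
      unfolding esc_mset_def by (intro image_mset_cong) simp
    also have "mset_set {1..n} = image_mset Suc (mset_set {0..<n})"
      by (simp add: image_mset_mset_set atLeastLessThanSuc_atLeastAtMost)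
    also have "image_mset (\<lambda>i. xs ! (i - 1)) (image_mset Suc (mset_set {0..<n})) = mset (map (\<lambda>i. xs ! i) [0..<n])"
      by (simp add: image_mset.compositionality comp_def)
    also have "\<dots> = M" using xs len map_nth[of xs] by simp
    finally show ?thesis .
  qed
  ultimately show thesis using that by blast
qed

text \<open>\<phi> corresponds to A, and \<sigma> is the permutation witnessing that two families
  over the same index set have equal multisets of values.\<close>

lemma ESC_isomorphic_iff:
  assumes J: "finite J" and X: "X \<in> ESC G F J" and Y: "Y \<in> ESC G F J"
  shows "ESC_isomorphic G J X G J Y \<longleftrightarrow> (\<exists>A\<in>GL s. image_mset (dual_act s A) (esc_mset J X) = esc_mset J Y)"
proof -
  have gX: "fst X i \<in> carrier G" "snd X i \<in> characters G F" if "i \<in> J" for i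
    using X that by (auto simp: ESC_def PiE_iff)
  have gY: "fst Y i \<in> carrier G" "snd Y i \<in> characters G F" if "i \<in> J" for i
    using Y that by (auto simp: ESC_def PiE_iff)
  \<comment> \<open>For matching \<phi> and A, the two conditions at one pair of indices are the two
    components of a single equation between points.\<close>
  have key: "(\<phi> (fst X i) = fst Y j \<and> (\<forall>x\<in>carrier G. snd Y j (\<phi> x) = snd X i x)) \<longleftrightarrow>
      dual_act s A (point X i) = point Y j"
    if \<phi>: "\<phi> \<in> iso G G" "\<And>x. x \<in> carrier G \<Longrightarrow> \<theta> (\<phi> x) = A *\<^sub>v \<theta> x" and A: "A \<in> GL s"
      and ij: "i \<in> J" "j \<in> J" for \<phi> A i j
  proof -
    have \<phi>c: "\<phi> x \<in> carrier G" if "x \<in> carrier G" for x using \<phi> that by (auto simp: iso_def hom_def)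
    have "\<phi> (fst X i) = fst Y j \<longleftrightarrow> A *\<^sub>v \<theta> (fst X i) = \<theta> (fst Y j)"
      using \<phi>(2)[of "fst X i"] theta_inj[of "\<phi> (fst X i)" "fst Y j"] gX gY ij \<phi>c by auto
    moreover have "(\<forall>x\<in>carrier G. snd Y j (\<phi> x) = snd X i x) \<longleftrightarrow>
        (inv\<^bsub>GL_group s\<^esub> A)\<^sup>T *\<^sub>v chi_inv (snd X i) = chi_inv (snd Y j)"
    proof -
      have w: "chi_inv (snd X i) \<in> carrier_vec s" "chi_inv (snd Y j) \<in> carrier_vec s"
        using gX gY ij chi_inv by auto
      show ?thesis
        using chi_comp_iff[OF w GL_carrier[OF A] \<phi>c \<phi>(2)] dual_act_eq_iff[OF A w]
          chi_inv(2)[OF gX(2)[OF ij(1)]] chi_inv(2)[OF gY(2)[OF ij(2)]] by simp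
    qed
    ultimately show ?thesis by (simp add: dual_act_def point_def)
  qed
  show ?thesis
  proof
    assume "ESC_isomorphic G J X G J Y"
    then obtain \<phi> \<sigma> where \<phi>: "\<phi> \<in> iso G G" and \<sigma>: "bij_betw \<sigma> J J"
      and eq: "\<And>i. i \<in> J \<Longrightarrow> \<phi> (fst X i) = fst Y (\<sigma> i) \<and> (\<forall>x\<in>carrier G. snd Y (\<sigma> i) (\<phi> x) = snd X i x)"
      unfolding ESC_isomorphic_def by blast
    obtain A where A: "A \<in> GL s" "\<And>x. x \<in> carrier G \<Longrightarrow> \<theta> (\<phi> x) = A *\<^sub>v \<theta> x"
      using iso_imp_GL[OF \<phi>] by blast
    have "dual_act s A (point X i) = point Y (\<sigma> i)" if "i \<in> J" for i
      using key[OF \<phi> A(2) A(1) that, of "\<sigma> i"] eq[OF that] \<sigma> that by (auto simp: bij_betw_def)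
    then have "image_mset (dual_act s A) (esc_mset J X) = image_mset (\<lambda>i. point Y (\<sigma> i)) (mset_set J)"
      using J by (auto simp: esc_mset_def image_mset.compositionality intro!: image_mset_cong)
    also have "\<dots> = image_mset (point Y) (image_mset \<sigma> (mset_set J))"
      by (simp add: image_mset.compositionality comp_def)
    also have "image_mset \<sigma> (mset_set J) = mset_set J"
      using \<sigma> by (simp add: image_mset_mset_set bij_betw_def)
    finally show "\<exists>A\<in>GL s. image_mset (dual_act s A) (esc_mset J X) = esc_mset J Y"
      using A by (auto simp: esc_mset_def)
  next
    assume "\<exists>A\<in>GL s. image_mset (dual_act s A) (esc_mset J X) = esc_mset J Y"
    then obtain A where A: "A \<in> GL s" and eq: "image_mset (dual_act s A) (esc_mset J X) = esc_mset J Y" by blast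
    from eq have "image_mset (\<lambda>i. dual_act s A (point X i)) (mset_set J) = image_mset (point Y) (mset_set J)"
      by (simp add: esc_mset_def image_mset.compositionality comp_def)
    from image_mset_eq_implies_permutes[OF J this]
    obtain \<sigma> where \<sigma>: "\<sigma> permutes J" "\<forall>i\<in>J. dual_act s A (point X i) = point Y (\<sigma> i)" by blast
    obtain \<phi> where \<phi>: "\<phi> \<in> iso G G" "\<And>x. x \<in> carrier G \<Longrightarrow> \<theta> (\<phi> x) = A *\<^sub>v \<theta> x"
      using GL_imp_iso[OF A GL_carrier[OF GL_inverse(1)[OF A]] GL_inverse(2,3)[OF A]] by blast
    have "\<phi> (fst X i) = fst Y (\<sigma> i) \<and> (\<forall>x\<in>carrier G. snd Y (\<sigma> i) (\<phi> x) = snd X i x)" if "i \<in> J" for i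
      using key[OF \<phi> A that, of "\<sigma> i"] \<sigma> that by (auto simp: permutes_in_image)
    then show "ESC_isomorphic G J X G J Y"
      unfolding ESC_isomorphic_def using \<phi>(1) permutes_imp_bij[OF \<sigma>(1)] by blast
  qed
qed

text \<open>Burnside's lemma for GL(s,p) on multisets of size n. Every such multiset comes from an
  element system, and isomorphism means lying in the same orbit, so classes and orbits are equally
  many.\<close>

lemma num_ESC_classes_mult_card_GL:
  "num_ESC_classes G F n * card (GL s :: 'p mod_ring mat set) =
    (\<Sum>A\<in>(GL s :: 'p mod_ring mat set). card (fixed_msets (dual_act s A) (vec_pairs s) n))"
proof -
  let ?H = "GL_group s :: 'p mod_ring mat monoid" and ?E = "msets_of_size (vec_pairs s :: ('p mod_ring vec \<times> 'p mod_ring vec) set) n"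
  let ?S = "ESC G F {1..n}" and ?m = "esc_mset {1..n}"
  define \<psi> where "\<psi> A = (\<lambda>M\<in>?E. image_mset (dual_act s A) M)" for A :: "'p mod_ring mat"
  have mset_cong: "image_mset f M = image_mset g M" if "M \<in> ?E" "\<And>x. x \<in> vec_pairs s \<Longrightarrow> f x = g x"
    for M and f g :: "_ \<Rightarrow> 'p mod_ring vec \<times> 'p mod_ring vec"
    using that by (intro image_mset_cong) (auto simp: msets_of_size_def)
  have action: "group_action ?H ?E \<psi>"
    unfolding \<psi>_def
  proof (rule group_actionI[OF group_GL_group])
    fix A M assume "A \<in> carrier ?H" "M \<in> ?E"
    then show "image_mset (dual_act s A) M \<in> ?E"
      using dual_act_closed[of A s] by (fastforce simp: msets_of_size_def)
  next
    fix M assume "M \<in> ?E"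
    then have "image_mset (dual_act s (1\<^sub>m s)) M = image_mset id M"
      by (rule mset_cong) (simp add: dual_act_one)
    then show "image_mset (dual_act s \<one>\<^bsub>?H\<^esub>) M = M" by simp
  next
    fix A B M assume AB: "A \<in> carrier ?H" "B \<in> carrier ?H" and M: "M \<in> ?E"
    have "image_mset (dual_act s (A * B)) M = image_mset (\<lambda>x. dual_act s A (dual_act s B x)) M"
      using M by (rule mset_cong) (use AB dual_act_mult in simp)
    then show "image_mset (dual_act s (A \<otimes>\<^bsub>?H\<^esub> B)) M = image_mset (dual_act s A) (image_mset (dual_act s B) M)"
      by (simp add: image_mset.compositionality comp_def)
  qed
  interpret A: group_action ?H ?E \<psi> by (rule action)
  have m_closed: "?m X \<in> ?E" if "X \<in> ?S" for X using esc_mset_closed[OF _ that] by simp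
  have equiv: "equiv ?S (ESC_rel G F {1..n})" by (rule equiv_ESC_rel) (rule G.group_axioms)
  have orbit_iff: "orbit ?H \<psi> (?m X) = orbit ?H \<psi> (?m Y) \<longleftrightarrow> (X, Y) \<in> ESC_rel G F {1..n}"
    if XY: "X \<in> ?S" "Y \<in> ?S" for X Y
  proof -
    have "orbit ?H \<psi> (?m X) = orbit ?H \<psi> (?m Y) \<longleftrightarrow> ?m Y \<in> orbit ?H \<psi> (?m X)"
    proof
      assume "orbit ?H \<psi> (?m X) = orbit ?H \<psi> (?m Y)"
      then show "?m Y \<in> orbit ?H \<psi> (?m X)" using A.orbit_refl m_closed XY by simp
    next
      assume YX: "?m Y \<in> orbit ?H \<psi> (?m X)"
      have sub: "orbit ?H \<psi> M \<subseteq> ?E" if "M \<in> ?E" for M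
        using A.element_image that by (auto simp: orbit_def)
      have "orbit ?H \<psi> M \<subseteq> orbit ?H \<psi> N" if "M \<in> ?E" "N \<in> ?E" "M \<in> orbit ?H \<psi> N" for M N
        using A.orbit_trans[OF that(2,1) _ that(3)] sub[OF that(1)] by blast
      then show "orbit ?H \<psi> (?m X) = orbit ?H \<psi> (?m Y)"
        using YX A.orbit_sym[OF _ _ YX] m_closed XY by blast
    qed
    also have "\<dots> \<longleftrightarrow> (\<exists>A\<in>GL s. image_mset (dual_act s A) (?m X) = ?m Y)"
    proof -
      have "\<psi> A (?m X) = image_mset (dual_act s A) (?m X)" for A
        using m_closed[OF XY(1)] by (simp add: \<psi>_def)
      then show ?thesis unfolding orbit_def GL_group_simps by (simp only: mem_Collect_eq) metis
    qed
    also have "\<dots> \<longleftrightarrow> (X, Y) \<in> ESC_rel G F {1..n}"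
      using ESC_isomorphic_iff[OF _ XY] XY by (simp add: ESC_rel_def)
    finally show ?thesis .
  qed
  have "num_ESC_classes G F n = card ((\<lambda>X. ESC_rel G F {1..n} `` {X}) ` ?S)"
    unfolding num_ESC_classes_def quotient_def by (rule arg_cong[of _ _ card]) auto
  \<comment> \<open>Mapping a system to its class and mapping it to the orbit of its multiset
    identify the same systems.\<close>
  also have "\<dots> = card ((\<lambda>X. orbit ?H \<psi> (?m X)) ` ?S)"
    by (rule card_image_eq_if_same_kernel) (simp only: orbit_iff eq_equiv_class_iff[OF equiv])
  also have "(\<lambda>X. orbit ?H \<psi> (?m X)) ` ?S = orbits ?H ?E \<psi>"
  proof -
    have "?m ` ?S = ?E"
    proof (intro equalityI subsetI)
      fix M assume "M \<in> ?E"
      then obtain X where "X \<in> ?S" "?m X = M" by (rule esc_mset_surj)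
      then show "M \<in> ?m ` ?S" by blast
    qed (use m_closed in blast)
    moreover have "(\<lambda>X. orbit ?H \<psi> (?m X)) ` ?S = orbit ?H \<psi> ` (?m ` ?S)" by (simp only: image_image)
    moreover have "orbit ?H \<psi> ` ?E = orbits ?H ?E \<psi>" by (auto simp: orbits_def)
    ultimately show ?thesis by simp
  qed
  finally have "num_ESC_classes G F n * card (GL s :: 'p mod_ring mat set) = card (orbits ?H ?E \<psi>) * Coset.order ?H"
    by (simp add: Coset.order_def)
  also have "\<dots> = (\<Sum>A\<in>carrier ?H. card (invariants ?E \<psi> A))"
  proof (rule A.burnside)
    \<comment> \<open>\<open>card\<close> is 0 on infinite sets, so positivity of the known order
      proves finiteness.\<close>
    show "finite (carrier ?H)"
      using card_GL_real[of s, where 'k = "'p mod_ring"] prime_gt_1_nat[OF prime_card[where 'a = 'p]]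
      by (intro card_ge_0_finite) (simp add: card_GL)
    show "finite ?E" by (rule finite_msets_of_size) simp
  qed
  also have "\<dots> = (\<Sum>A\<in>(GL s :: 'p mod_ring mat set). card (fixed_msets (dual_act s A) (vec_pairs s) n))"
    by (intro sum.cong arg_cong[of _ _ card]) (auto simp: invariants_def fixed_msets_def \<psi>_def)
  finally show ?thesis .
qed

end

section \<open>Coordinates for the given group and the final count\<close>

text \<open>Supplies the coordinates of \<open>vector_group\<close>. Components are reduced to
  {0..p-1}, which \<open>of_int\<close> identifies with Z_p and on which reduction mod p becomes
  invisible; \<open>Suc i\<close> shifts from vector indices to {1..s}.\<close>

lemma product_integer_mod_group_vec:
  assumes p: "CARD('p::prime_card) = p"
    and h: "h \<in> iso G (product_group {1..s} (\<lambda>_. integer_mod_group p))"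
  defines "\<theta> \<equiv> \<lambda>x. vec s (\<lambda>i. of_int (h x (Suc i)) :: 'p mod_ring)"
  shows "bij_betw \<theta> (carrier G) (carrier_vec s)"
    and "\<And>x y. x \<in> carrier G \<Longrightarrow> y \<in> carrier G \<Longrightarrow> \<theta> (x \<otimes>\<^bsub>G\<^esub> y) = \<theta> x + \<theta> y"
proof -
  \<comment> \<open>\<open>integer_mod_group 0\<close> is the group of all integers, so this is
    needed for the carrier to be {0..p-1}.\<close>
  have p0: "p \<noteq> 0" using p by (metis card_eq_0_iff finite UNIV_not_empty)
  let ?P = "{1..s} \<rightarrow>\<^sub>E {0..<int p}"
  have bh: "bij_betw h (carrier G) ?P"
    using h p0 by (simp add: iso_def carrier_integer_mod_group)
  let ?v = "\<lambda>f. vec s (\<lambda>i. of_int (f (Suc i)) :: 'p mod_ring)"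
  have bv: "bij_betw ?v ?P (carrier_vec s)"
  proof (rule bij_betw_byWitness[where f' = "\<lambda>v. \<lambda>i\<in>{1..s}. to_int_mod_ring (v $ (i - 1))"])
    show "\<forall>f\<in>?P. (\<lambda>i\<in>{1..s}. to_int_mod_ring (?v f $ (i - 1))) = f"
    proof
      fix f assume f: "f \<in> ?P"
      show "(\<lambda>i\<in>{1..s}. to_int_mod_ring (?v f $ (i - 1))) = f"
      proof (rule extensionalityI[of _ "{1..s}"])
        fix i assume i: "i \<in> {1..s}"
        then have "0 \<le> f i" "f i < int CARD('p)" using f p by (auto simp: PiE_iff)
        then show "(\<lambda>i\<in>{1..s}. to_int_mod_ring (?v f $ (i - 1))) i = f i"
          using i by (auto simp: of_int_of_int_mod_ring)
      qed (use f in \<open>auto simp: PiE_iff\<close>)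
    qed
    show "\<forall>v\<in>carrier_vec s. ?v (\<lambda>i\<in>{1..s}. to_int_mod_ring (v $ (i - 1))) = v"
      by (intro ballI eq_vecI) (simp_all add: of_int_of_int_mod_ring)
    have "to_int_mod_ring (a :: 'p mod_ring) \<in> {0..<int p}" for a
      using range_to_int_mod_ring[where 'a = 'p] p by auto
    then show "(\<lambda>v. \<lambda>i\<in>{1..s}. to_int_mod_ring ((v :: 'p mod_ring vec) $ (i - 1))) ` carrier_vec s \<subseteq> ?P"
      by (simp only: image_subset_iff restrict_PiE_iff) blast
  qed (simp add: image_subset_iff)
  show "bij_betw \<theta> (carrier G) (carrier_vec s)"
    using bij_betw_trans[OF bh bv] by (simp add: \<theta>_def comp_def)
  have mod: "of_int (k mod int p) = (of_int k :: 'p mod_ring)" for k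
    unfolding of_int_of_int_mod_ring using p by transfer simp
  fix x y assume xy: "x \<in> carrier G" "y \<in> carrier G"
  have "h (x \<otimes>\<^bsub>G\<^esub> y) = (\<lambda>i\<in>{1..s}. (h x i + h y i) mod int p)"
    using h xy by (simp add: iso_def hom_def)
  then show "\<theta> (x \<otimes>\<^bsub>G\<^esub> y) = \<theta> x + \<theta> y"
    by (intro eq_vecI) (simp_all add: \<theta>_def mod)
qed

theorem theorem4p2:
  fixes G :: "('a, 'm) monoid_scheme"
    and F :: "('f, 'r) ring_scheme"
    and p s n :: nat
  assumes "prime p" and "CARD('p::prime_card) = p"
    and "s > 0" and "n > 0"
    and "comm_group G"
    and "G \<cong> product_group {1..s} (\<lambda>_. integer_mod_group p)"
    and "field F"
    and "\<exists>z \<in> carrier (mult_of F). group.ord (mult_of F) z = Coset.order G"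
  shows "real (num_ESC_classes G F n) =
    1 / (real p ^ (s * (s - 1) div 2) * (\<Prod>i = 1..s. (real p ^ i - 1))) *
    (\<Sum>A \<in> (GL s :: 'p mod_ring mat set). \<Sum>l \<in> cycle_types n.
      \<Prod>i = 1..n. real p ^ (2 * (s - vec_space.rank s (A ^\<^sub>m i - 1\<^sub>m s)) * l i)
                   / (fact (l i) * real i ^ l i))"
proof -
  interpret G: comm_group G by fact
  interpret F: field F by fact
  interpret U: group "mult_of F" by (rule F.field_mult_group)
  obtain h where h: "h \<in> iso G (product_group {1..s} (\<lambda>_. integer_mod_group p))"
    using assms(6) by (auto simp: is_iso_def)
  note \<theta> = product_integer_mod_group_vec[OF assms(2) h]
  \<comment> \<open>The order p^s is split as p * p^(s-1), possible as s > 0, to show which power of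
    z has order p.\<close>
  have order: "Coset.order G = p * p ^ (s - 1)"
    using bij_betw_same_card[OF \<theta>(1)] \<open>s > 0\<close> assms(2)
    by (simp add: Coset.order_def card_carrier_vec flip: power_Suc)
  obtain z where z: "z \<in> carrier (mult_of F)" "U.ord z = p * p ^ (s - 1)"
    using assms(8) order by auto
  have p0: "p > 1" using assms(1) by (rule prime_gt_1_nat)
  have "U.ord (z [^]\<^bsub>mult_of F\<^esub> (p ^ (s - 1))) = p"
    using U.ord_pow[OF z(1), of "p ^ (s - 1)"] z(2) p0 by simp
  then interpret V: vector_group G F "\<lambda>x. vec s (\<lambda>i. of_int (h x (Suc i)) :: 'p mod_ring)" s
    "z [^]\<^bsub>mult_of F\<^esub> (p ^ (s - 1))"
    using \<theta> z(1) assms(2)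
    by unfold_locales (simp_all only: U.nat_pow_closed)
  have types: "cycle_types n = cycle_types_bounded n n"
    by (simp add: cycle_types_def cycle_types_bounded_def)
  have "real (num_ESC_classes G F n) * real (card (GL s :: 'p mod_ring mat set)) =
      (\<Sum>A\<in>(GL s :: 'p mod_ring mat set). real (card (fixed_msets (dual_act s A) (vec_pairs s) n)))"
    using V.num_ESC_classes_mult_card_GL[of n] by (metis of_nat_mult of_nat_sum)
  also have "\<dots> = (\<Sum>A \<in> (GL s :: 'p mod_ring mat set). \<Sum>l \<in> cycle_types n.
      \<Prod>i = 1..n. real p ^ (2 * (s - vec_space.rank s (A ^\<^sub>m i - 1\<^sub>m s)) * l i)
                   / (fact (l i) * real i ^ l i))"
    using assms(2) by (intro sum.cong refl) (simp add: card_fixed_msets_dual_act types cycle_sum_def power_mult)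
  finally have eq: "real (num_ESC_classes G F n) * real (card (GL s :: 'p mod_ring mat set)) = \<dots>" .
  have GL: "real (card (GL s :: 'p mod_ring mat set)) = real p ^ (s * (s - 1) div 2) * (\<Prod>i = 1..s. (real p ^ i - 1))"
    using card_GL_real[of s, where 'k = "'p mod_ring"] assms(2) by simp
  \<comment> \<open>Needed to divide Burnside's identity by the group order.\<close>
  have "real (card (GL s :: 'p mod_ring mat set)) \<noteq> 0"
  proof -
    have "real p ^ i - 1 \<noteq> 0" if "i \<in> {1..s}" for i
    proof -
      have "1 < real p ^ i" using p0 that by (intro one_less_power) auto
      then show ?thesis by simp
    qed
    then show ?thesis unfolding GL using p0 by simp
  qed
  then show ?thesis unfolding GL[symmetric] eq[symmetric] by simp
qed

end
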